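(* Let $Y$ be a Lévy process in $\mathbb{R}^d$. The following are equivalent: (D1) There are $T_1,c_1>0$ such that the density $p(t,x)$ of $Y_t$ exists for all $t>T_1$ and $\sup_{x}p(t,x)\le c_1[h^{-1}(1/t)]^{-d}$ for $t>T_1$. (D2) There are $T_2,c_2>0$ such that $\int_{\mathbb{R}^d}e^{-t\,\mathrm{Re}[\Psi(z)]}dz\le c_2[h^{-1}(1/t)]^{-d}$ for all $t>T_2$. (D3) There are $T_3>0$, $c_3\in(0,1]$, $\alpha_3\in(0,2]$ such that $c_3\Psi^*(|x|)\le\mathrm{Re}[\Psi(x)]$ for all $|x|<1/T_3$ and $\Psi^*(\lambda r)\le c_3^{-1}\lambda^{\alpha_3}\Psi^*(r)$ for all $\lambda\le1$, $r<1/T_3$; and $e^{-t_0\Psi}\in L^1(\mathbb{R}^d)$ for some $t_0>0$. (D4) There are $T_4>0$, $c_4\in[1,\infty)$ such that for all $|x|<1/T_4$, $\Psi^*(|x|)\le c_4\big(\langle x,Ax\rangle+\int_{|\langle x,z\rangle|<1}|\langle x,z\rangle|^2N(dz)\big)$; and $e^{-t_0\Psi}\in L^1(\mathbb{R}^d)$ for some $t_0>0$.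
   Context: $Y$ has generating triplet $(A,N,b)$ ($A$ symmetric non-negative definite matrix, $b\in\mathbb{R}^d$, $N$ Lévy measure) and characteristic exponent $\Psi$, $\mathbb{E}e^{i\langle x,Y_t\rangle}=e^{-t\Psi(x)}$. For $r>0$: $h(r)=r^{-2}\|A\|+\int(1\wedge|x|^2/r^2)N(dx)$, $\Psi^*(r)=\sup_{|z|\le r}\mathrm{Re}\,\Psi(z)$. Standing assumption $h(0^+)=\infty$; $h$ is continuous and strictly decreasing from $\infty$ to $0$ and $h^{-1}$ is its inverse. *)

theory Defs
  imports "HOL-Probability.Probability"
begin

definition sym_nonneg_matrix :: "real^'d^'d \<Rightarrow> bool" where
  "sym_nonneg_matrix A \<longleftrightarrow> transpose A = A \<and> (\<forall>x. 0 \<le> x \<bullet> (A *v x))"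

definition levy_measure :: "(real^'d) measure \<Rightarrow> bool" where
  "levy_measure N \<longleftrightarrow> sets N = sets borel \<and> emeasure N {0} = 0 \<and>
     (\<integral>\<^sup>+ x. ennreal (min 1 ((norm x)\<^sup>2)) \<partial>N) < \<infinity>"

text \<open>Characteristic exponent given by the Levy-Khintchine formula,
  E exp(i<x,Y_t>) = exp(-t Psi(x)).\<close>
definition levy_exponent :: "real^'d^'d \<Rightarrow> (real^'d) measure \<Rightarrow> real^'d \<Rightarrow> real^'d \<Rightarrow> complex" where
  "levy_exponent A N b x =
     complex_of_real ((x \<bullet> (A *v x)) / 2) - \<i> * complex_of_real (b \<bullet> x)
     + (\<integral> z. (1 - exp (\<i> * complex_of_real (x \<bullet> z))
                 + \<i> * complex_of_real (x \<bullet> z) * indicator {z. norm z < 1} z) \<partial>N)"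

definition hfun :: "real^'d^'d \<Rightarrow> (real^'d) measure \<Rightarrow> real \<Rightarrow> real" where
  "hfun A N r = onorm (\<lambda>x. A *v x) / r\<^sup>2 + (\<integral> x. min 1 ((norm x)\<^sup>2 / r\<^sup>2) \<partial>N)"

definition hinv :: "real^'d^'d \<Rightarrow> (real^'d) measure \<Rightarrow> real \<Rightarrow> real" where
  "hinv A N s = (THE r. 0 < r \<and> hfun A N r = s)"

definition psi_star :: "(real^'d \<Rightarrow> complex) \<Rightarrow> real \<Rightarrow> real" where
  "psi_star \<Psi> r = Sup {Re (\<Psi> z) | z. norm z \<le> r}"

definition levy_process :: "'a measure \<Rightarrow> (real \<Rightarrow> 'a \<Rightarrow> real^'d) \<Rightarrow> bool" where
  "levy_process M Y \<longleftrightarrow> prob_space M \<and>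
     (\<forall>t. Y t \<in> borel_measurable M) \<and>
     (AE \<omega> in M. Y 0 \<omega> = 0) \<and>
     (\<forall>ts. sorted_wrt (<) ts \<and> (\<forall>t\<in>set ts. 0 \<le> t) \<longrightarrow>
        prob_space.indep_vars M (\<lambda>_. borel) (\<lambda>i \<omega>. Y (ts ! Suc i) \<omega> - Y (ts ! i) \<omega>)
          {..<length ts - 1}) \<and>
     (\<forall>s t. 0 \<le> s \<longrightarrow> 0 \<le> t \<longrightarrow>
        distr M borel (\<lambda>\<omega>. Y (s + t) \<omega> - Y s \<omega>) = distr M borel (Y t)) \<and>
     (\<forall>s\<ge>0. \<forall>e>0. ((\<lambda>t. measure M {\<omega>\<in>space M. e < norm (Y t \<omega> - Y s \<omega>)}) \<longlongrightarrow> 0)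
        (at s within {0..})) \<and>
     (AE \<omega> in M. (\<forall>t\<ge>0. continuous (at_right t) (\<lambda>s. Y s \<omega>)) \<and>
                 (\<forall>t>0. \<exists>l. ((\<lambda>s. Y s \<omega>) \<longlongrightarrow> l) (at_left t)))"

end

theory Submission
  imports Defs "HOL-Real_Asymp.Real_Asymp"
begin

text \<open>
  All four conditions are equivalent to the conjunction of three facts: \<open>h\<close> decays polynomially at
  infinity (\<open>h (m r) \<le> h r / 2\<close> for large \<open>r\<close>), \<open>Re \<Psi> x\<close> is comparable to \<open>h (1 / |x|)\<close> for small \<open>x\<close>,
  and \<open>exp (- t\<^sub>0 Re \<Psi>)\<close> is integrable for some \<open>t\<^sub>0\<close>.

  Gaussian regularisation shows that a density bounded by \<open>C\<close> has a characteristic function with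
  squared \<open>L\<^sup>2\<close>-norm at most \<open>(2 \<pi>)\<^sup>d C\<close>, and that an integrable characteristic function gives a
  bounded density. The first bound only controls \<open>exp (- 2 t Re \<Psi>)\<close>. Restricting the integral to the
  ball of radius \<open>1 / r'\<close> with \<open>r' = h\<^sup>-\<^sup>1(1 / t) / m\<close> forces \<open>h\<close> to decay, which allows \<open>2 t\<close> to be replaced by \<open>t\<close>;
  restricting it to disjoint balls around the multiples of a vector \<open>x\<close> forces \<open>Re \<Psi> x\<close> to be large.
  Conversely, the three facts bound \<open>exp (- t Re \<Psi>)\<close> by a stretched exponential near the origin and by
  an exponentially small multiple of \<open>exp (- t\<^sub>0 Re \<Psi>)\<close> elsewhere.
\<close>

section \<open>Gaussian regularisation of characteristic functions\<close>

text \<open>The squared modulus of the characteristic function bounds \<open>exp_int (2 * t)\<close>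
  at the scale \<open>hinv A N (1 / t)\<close>: time is doubled on one side only. Undoing this means
  \<open>hinv A N (1 / (2 * t))\<close> \<le> m * \<open>hinv A N (1 / t)\<close>, which is the
  decay of h itself and cannot be presupposed, since h may vary slowly at infinity. So the bound
  with doubled time, weaker than (D2), becomes the hypothesis from which decay and nondegeneracy are
  extracted, both times by counting volume. (D3) enters because Psi* (r) and h (1 / r) are
  comparable. At a single point Re Psi need not dominate the concentration function, because 1 - cos
  returns to 0. A supremum over a ball admits averaging 1 - cos (u s) over u in [0, 1], and the mean
  1 - sin s / s dominates min 1 (s^2) up to a constant. (D4) enters because the truncated second
  moment is the rate at which the concentration function of a projection falls as the radius grows.
  It is comparable to the function itself exactly when a fixed share is lost at each
  rescaling.\<close>

definition gauss :: "'a::euclidean_space \<Rightarrow> real" where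
  "gauss x = (\<Prod>b\<in>Basis. std_normal_density (x \<bullet> b))"

lemma gauss_eq:
  "gauss (x::'a::euclidean_space) = exp (- (norm x)\<^sup>2 / 2) / sqrt (2 * pi) ^ DIM('a)"
proof -
  have "(norm x)\<^sup>2 = (\<Sum>b\<in>Basis. (x \<bullet> b)\<^sup>2)"
    unfolding power2_norm_eq_inner by (subst euclidean_inner) (simp add: power2_eq_square)
  then have "exp (- (norm x)\<^sup>2 / 2) = (\<Prod>b\<in>Basis. exp (- (x \<bullet> b)\<^sup>2 / 2))"
    by (simp add: exp_sum[symmetric] sum_divide_distrib sum_negf)
  then show ?thesis
    by (simp add: gauss_def normal_density_def prod.distrib prod_dividef power_divide)
qed

lemma gauss_nonneg [simp]: "0 \<le> gauss x"
  by (simp add: gauss_eq)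

lemma gauss_le: "gauss (x::'a::euclidean_space) \<le> 1 / sqrt (2 * pi) ^ DIM('a)"
  by (simp add: gauss_eq divide_right_mono)

lemma borel_measurable_gauss [measurable]: "gauss \<in> borel_measurable borel"
  unfolding gauss_eq[abs_def] by measurable

definition gauss_measure :: "'a::euclidean_space measure" where
  "gauss_measure = density lborel (\<lambda>x. ennreal (gauss x))"

lemma sets_gauss_measure [measurable_cong, simp]: "sets gauss_measure = sets borel"
  by (simp add: gauss_measure_def)

lemma space_gauss_measure [simp]: "space gauss_measure = UNIV"
  by (simp add: gauss_measure_def)

lemma prob_space_gauss_measure: "prob_space (gauss_measure :: 'a::euclidean_space measure)"
proof
  have "(\<integral>\<^sup>+x. ennreal (gauss x) \<partial>(lborel :: 'a measure)) =
      (\<integral>\<^sup>+x. (\<Prod>b\<in>Basis. ennreal (std_normal_density (x \<bullet> b))) \<partial>(lborel :: 'a measure))"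
    by (simp add: gauss_def prod_ennreal)
  also have "\<dots> = (\<Prod>b\<in>(Basis :: 'a set). \<integral>\<^sup>+x. ennreal (std_normal_density x) \<partial>lborel)"
    by (rule nn_integral_lborel_prod) auto
  also have "\<dots> = 1"
  proof -
    have "emeasure (density lborel (\<lambda>x. ennreal (std_normal_density x))) UNIV = 1"
      using prob_space.emeasure_space_1[OF prob_space_normal_density[of 1 0]] by simp
    then show ?thesis by (simp add: emeasure_density)
  qed
  finally show "emeasure (gauss_measure :: 'a measure) (space gauss_measure) = 1"
    by (simp add: gauss_measure_def emeasure_density)
qed

text \<open>Density and exponential are both products over the coordinates, so the integral factors
  into one-dimensional characteristic functions of the standard normal law.\<close>

lemma char_gauss_measure:
  fixes x :: "'a::euclidean_space"
  shows "(\<integral>w. exp (\<i> * complex_of_real (w \<bullet> x)) \<partial>gauss_measure) = complex_of_real (exp (- (norm x)\<^sup>2 / 2))"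
proof -
  let ?f = "\<lambda>b u. complex_of_real (std_normal_density u) * exp (\<i> * complex_of_real (u * (x \<bullet> b)))"
  interpret product_sigma_finite "\<lambda>_::'a. lborel :: real measure" ..
  have int: "integrable lborel (?f b)" for b
  proof (rule Bochner_Integration.integrable_bound[where f="std_normal_density"])
    show "AE u in lborel. norm (?f b u) \<le> norm (std_normal_density u)"
      by (auto simp: norm_mult norm_exp_i_times)
  qed (auto intro!: integrable_normal_density)
  have one: "integral\<^sup>L lborel (?f b) = complex_of_real (exp (- (x \<bullet> b)\<^sup>2 / 2))" for b
  proof -
    have "integral\<^sup>L lborel (?f b) = char std_normal_distribution (x \<bullet> b)"
      unfolding char_def
      by (subst integral_density) (auto simp: scaleR_conv_of_real mult.commute)
    then show ?thesis by (simp add: char_std_normal_distribution)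
  qed
  have "(\<integral>w. exp (\<i> * complex_of_real (w \<bullet> x)) \<partial>gauss_measure)
     = (\<integral>w. (\<Prod>b\<in>Basis. ?f b (w \<bullet> b)) \<partial>lborel)"
    unfolding gauss_measure_def
  proof (subst integral_density)
    show "(\<integral>w. gauss w *\<^sub>R exp (\<i> * complex_of_real (w \<bullet> x)) \<partial>lborel) = (\<integral>w. (\<Prod>b\<in>Basis. ?f b (w \<bullet> b)) \<partial>lborel)"
      by (intro Bochner_Integration.integral_cong)
         (auto simp: gauss_def prod.distrib scaleR_conv_of_real exp_sum[symmetric]
            sum_distrib_left[symmetric] euclidean_inner[of _ x])
  qed auto
  also have "\<dots> = (\<integral>v. (\<Prod>b\<in>Basis. ?f b (v b)) \<partial>(\<Pi>\<^sub>M b\<in>Basis. lborel))"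
    by (subst lborel_eq, subst integral_distr)
       (auto intro!: Bochner_Integration.integral_cong prod.cong simp: inner_sum_left inner_Basis if_distrib sum.delta cong: if_cong)
  also have "\<dots> = (\<Prod>b\<in>Basis. integral\<^sup>L lborel (?f b))"
    by (rule product_integral_prod) (use int in auto)
  also have "\<dots> = complex_of_real (\<Prod>b\<in>Basis. exp (- (x \<bullet> b)\<^sup>2 / 2))"
    unfolding one by simp
  also have "(\<Prod>b\<in>Basis. exp (- (x \<bullet> b)\<^sup>2 / 2)) = exp (- (norm x)\<^sup>2 / 2)"
    unfolding power2_norm_eq_inner
    by (subst (2) euclidean_inner)
       (simp add: exp_sum[symmetric] sum_divide_distrib[symmetric] sum_negf power2_eq_square)
  finally show ?thesis .
qed

lemma nn_integral_lborel_affine: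
  fixes f :: "'a::euclidean_space \<Rightarrow> ennreal"
  assumes [measurable]: "f \<in> borel_measurable borel" and c: "c \<noteq> 0"
  shows "(\<integral>\<^sup>+x. f x \<partial>lborel) = ennreal (\<bar>c\<bar> ^ DIM('a)) * (\<integral>\<^sup>+x. f (t + c *\<^sub>R x) \<partial>lborel)"
  by (subst lborel_affine[OF c, of t])
     (simp add: nn_integral_density nn_integral_distr nn_integral_cmult)

definition char_fun :: "'a::euclidean_space measure \<Rightarrow> 'a \<Rightarrow> complex" where
  "char_fun \<mu> z = (\<integral>y. exp (\<i> * complex_of_real (z \<bullet> y)) \<partial>\<mu>)"

lemma borel_measurable_char_fun [measurable]:
  assumes "prob_space \<mu>" and [measurable_cong]: "sets \<mu> = sets borel"
  shows "char_fun \<mu> \<in> borel_measurable borel"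
proof -
  interpret prob_space \<mu> by fact
  show ?thesis unfolding char_fun_def[abs_def] by measurable
qed

lemma norm_char_fun_le:
  assumes "prob_space \<mu>"
  shows "cmod (char_fun \<mu> z) \<le> 1"
proof -
  interpret prob_space \<mu> by fact
  have "cmod (char_fun \<mu> z) \<le> (\<integral>y. cmod (exp (\<i> * complex_of_real (z \<bullet> y))) \<partial>\<mu>)"
    unfolding char_fun_def by (rule integral_norm_bound)
  then show ?thesis by (simp add: prob_space)
qed

lemma char_fun_uminus: "char_fun \<mu> (- z) = cnj (char_fun \<mu> z)"
proof -
  have "cnj (exp (\<i> * complex_of_real u)) = exp (\<i> * complex_of_real (- u))" for u
    by (simp add: exp_cnj)
  then show ?thesis by (simp add: char_fun_def flip: Bochner_Integration.integral_cnj)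
qed

text \<open>The Gaussian is its own Fourier transform up to normalisation: the kernel is an average
  of exponentials over a Gaussian w, and Fubini applies because these have modulus 1 on a product of
  probability spaces. The Gaussian weight supplies convergence for an arbitrary law
  \<open>\<mu>\<close>.\<close>

lemma gauss_smoothing_char_fun:
  fixes \<mu> :: "'a::euclidean_space measure"
  assumes "prob_space \<mu>" and sets[measurable_cong]: "sets \<mu> = sets borel"
  shows "complex_of_real (\<integral>y. exp (- (norm (s *\<^sub>R (x - y)))\<^sup>2 / 2) \<partial>\<mu>) =
     (\<integral>w. exp (\<i> * complex_of_real ((s *\<^sub>R w) \<bullet> x)) * char_fun \<mu> (- (s *\<^sub>R w)) \<partial>gauss_measure)"
proof -
  interpret prob_space \<mu> by fact
  interpret G: prob_space "gauss_measure :: 'a measure" by (rule prob_space_gauss_measure)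
  interpret P: pair_prob_space "gauss_measure :: 'a measure" \<mu> ..
  let ?e = "\<lambda>w y. exp (\<i> * complex_of_real (w \<bullet> (s *\<^sub>R (x - y))))"
  have "complex_of_real (\<integral>y. exp (- (norm (s *\<^sub>R (x - y)))\<^sup>2 / 2) \<partial>\<mu>) =
      (\<integral>y. (\<integral>w. ?e w y \<partial>gauss_measure) \<partial>\<mu>)"
    unfolding char_gauss_measure by (rule integral_complex_of_real[symmetric])
  also have "\<dots> = (\<integral>w. (\<integral>y. ?e w y \<partial>\<mu>) \<partial>gauss_measure)"
  proof (rule P.Fubini_integral)
    show "integrable (gauss_measure \<Otimes>\<^sub>M \<mu>) (\<lambda>(w, y). ?e w y)"
      by (rule P.P.integrable_const_bound[where B=1]) (auto simp: split_beta)
  qed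
  also have "?e = (\<lambda>w y. exp (\<i> * complex_of_real ((s *\<^sub>R w) \<bullet> x)) * exp (\<i> * complex_of_real ((- (s *\<^sub>R w)) \<bullet> y)))"
    by (simp add: fun_eq_iff exp_add[symmetric] inner_diff_right algebra_simps)
  finally show ?thesis by (simp add: char_fun_def)
qed

text \<open>Integrating the smoothing identity once more against \<open>\<mu>\<close> turns the
  remaining exponential into a second characteristic function, the conjugate of the first. This is a
  regularised Plancherel identity.\<close>

lemma gauss_smoothing_char_fun_sq:
  fixes \<mu> :: "'a::euclidean_space measure"
  assumes "prob_space \<mu>" and sets[measurable_cong]: "sets \<mu> = sets borel"
  shows "(\<integral>x. (\<integral>y. exp (- (norm (s *\<^sub>R (x - y)))\<^sup>2 / 2) \<partial>\<mu>) \<partial>\<mu>) =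
     (\<integral>w. (cmod (char_fun \<mu> (s *\<^sub>R w)))\<^sup>2 \<partial>gauss_measure)"
proof -
  interpret prob_space \<mu> by fact
  interpret G: prob_space "gauss_measure :: 'a measure" by (rule prob_space_gauss_measure)
  interpret P: pair_prob_space "gauss_measure :: 'a measure" \<mu> ..
  note [measurable] = borel_measurable_char_fun[OF assms]
  let ?e = "\<lambda>w x. exp (\<i> * complex_of_real ((s *\<^sub>R w) \<bullet> x)) * char_fun \<mu> (- (s *\<^sub>R w))"
  have "complex_of_real (\<integral>x. (\<integral>y. exp (- (norm (s *\<^sub>R (x - y)))\<^sup>2 / 2) \<partial>\<mu>) \<partial>\<mu>) =
      (\<integral>x. (\<integral>w. ?e w x \<partial>gauss_measure) \<partial>\<mu>)"
    unfolding gauss_smoothing_char_fun[OF assms, symmetric] by (rule integral_complex_of_real[symmetric])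
  also have "\<dots> = (\<integral>w. (\<integral>x. ?e w x \<partial>\<mu>) \<partial>gauss_measure)"
  proof (rule P.Fubini_integral)
    show "integrable (gauss_measure \<Otimes>\<^sub>M \<mu>) (\<lambda>(w, y). ?e w y)"
      by (rule P.P.integrable_const_bound[where B=1])
         (auto simp: split_beta norm_mult norm_char_fun_le[OF assms(1)])
  qed
  also have "\<dots> = (\<integral>w. complex_of_real ((cmod (char_fun \<mu> (s *\<^sub>R w)))\<^sup>2) \<partial>gauss_measure)"
    unfolding complex_norm_square char_fun_uminus by (simp add: char_fun_def)
  also have "\<dots> = complex_of_real (\<integral>w. (cmod (char_fun \<mu> (s *\<^sub>R w)))\<^sup>2 \<partial>gauss_measure)"
    by (rule integral_complex_of_real)
  finally show ?thesis by (simp only: of_real_eq_iff)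
qed

section \<open>Square-integrability of the characteristic function of a bounded density\<close>

lemma nn_integral_fatou_le:
  assumes "\<And>n. f n \<in> borel_measurable M"
    and "\<And>x. x \<in> space M \<Longrightarrow> g x \<le> liminf (\<lambda>n. f n x)"
    and "\<And>n. (\<integral>\<^sup>+x. f n x \<partial>M) \<le> (K::ennreal)"
  shows "(\<integral>\<^sup>+x. g x \<partial>M) \<le> K"
proof -
  have "(\<integral>\<^sup>+x. g x \<partial>M) \<le> (\<integral>\<^sup>+x. liminf (\<lambda>n. f n x) \<partial>M)"
    by (rule nn_integral_mono) (rule assms)
  also have "\<dots> \<le> liminf (\<lambda>n. \<integral>\<^sup>+x. f n x \<partial>M)"
    by (rule nn_integral_liminf) (rule assms)
  also have "\<dots> \<le> liminf (\<lambda>n::nat. K)"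
    by (rule Liminf_mono) (simp add: assms)
  finally show ?thesis by (simp add: Liminf_const)
qed

lemma nn_integral_exp_norm_sq:
  fixes t :: "'a::euclidean_space"
  assumes "0 < s"
  shows "(\<integral>\<^sup>+x. ennreal (exp (- (norm (s *\<^sub>R (t - x)))\<^sup>2 / 2)) \<partial>lborel) = ennreal (sqrt (2 * pi) ^ DIM('a) / s ^ DIM('a))"
proof -
  have "(\<integral>\<^sup>+x. ennreal (gauss x) \<partial>(lborel :: 'a measure)) = 1"
    using prob_space.emeasure_space_1[OF prob_space_gauss_measure[where 'a='a]]
    by (simp add: gauss_measure_def emeasure_density)
  also have "(\<integral>\<^sup>+x. ennreal (gauss x) \<partial>(lborel :: 'a measure)) =
      (\<integral>\<^sup>+x. ennreal (1 / sqrt (2 * pi) ^ DIM('a)) * ennreal (exp (- (norm x)\<^sup>2 / 2)) \<partial>(lborel :: 'a measure))"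
    by (simp add: gauss_eq flip: ennreal_mult')
  also have "\<dots> = ennreal (1 / sqrt (2 * pi) ^ DIM('a)) * (\<integral>\<^sup>+x. ennreal (exp (- (norm x)\<^sup>2 / 2)) \<partial>(lborel :: 'a measure))"
    by (rule nn_integral_cmult) simp
  finally have *: "1 = ennreal (1 / sqrt (2 * pi) ^ DIM('a)) * (\<integral>\<^sup>+x. ennreal (exp (- (norm x)\<^sup>2 / 2)) \<partial>(lborel :: 'a measure))"
    by simp
  have "ennreal (sqrt (2 * pi) ^ DIM('a)) = ennreal (sqrt (2 * pi) ^ DIM('a)) * 1" by simp
  also have "\<dots> = (\<integral>\<^sup>+x. ennreal (exp (- (norm x)\<^sup>2 / 2)) \<partial>(lborel :: 'a measure))"
    by (subst *) (simp add: mult.assoc[symmetric] ennreal_mult'[symmetric])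
  also have "\<dots> = ennreal (\<bar>- s\<bar> ^ DIM('a)) * (\<integral>\<^sup>+x. ennreal (exp (- (norm (s *\<^sub>R t + (- s) *\<^sub>R x))\<^sup>2 / 2)) \<partial>(lborel :: 'a measure))"
    using assms by (intro nn_integral_lborel_affine) auto
  also have "(\<lambda>x. s *\<^sub>R t + (- s) *\<^sub>R x) = (\<lambda>x. s *\<^sub>R (t - x))"
    by (simp add: algebra_simps)
  finally have "ennreal (sqrt (2 * pi) ^ DIM('a)) = ennreal (s ^ DIM('a)) * (\<integral>\<^sup>+x. ennreal (exp (- (norm (s *\<^sub>R (t - x)))\<^sup>2 / 2)) \<partial>lborel)"
    using assms by (simp add: algebra_simps)
  then have "ennreal (1 / s ^ DIM('a)) * ennreal (sqrt (2 * pi) ^ DIM('a)) = ennreal (1 / s ^ DIM('a)) * (ennreal (s ^ DIM('a)) * (\<integral>\<^sup>+x. ennreal (exp (- (norm (s *\<^sub>R (t - x)))\<^sup>2 / 2)) \<partial>lborel))"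
    by simp
  then show ?thesis using assms
    by (simp add: mult.assoc[symmetric] ennreal_mult'[symmetric])
qed


text \<open>By Plancherel the left side should be (2 pi)^d times the integral of p^2, which is at
  most C since p has mass 1. The proof damps the integrand by a Gaussian of width s; after z = s w
  the Jacobian s^d cancels the s^(-d) in the total mass of the smoothing kernel, so the bound is
  uniform in s.\<close>

lemma char_fun_L2_bound:
  fixes p :: "'a::euclidean_space \<Rightarrow> real"
  assumes \<mu>: "\<mu> = density lborel (\<lambda>x. ennreal (p x))" and "prob_space \<mu>"
    and [measurable]: "p \<in> borel_measurable borel" and p: "\<And>x. 0 \<le> p x" "\<And>x. p x \<le> C"
  shows "(\<integral>\<^sup>+z. ennreal ((cmod (char_fun \<mu> z))\<^sup>2) \<partial>lborel) \<le> ennreal ((2 * pi) ^ DIM('a) * C)"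
proof (rule nn_integral_fatou_le)
  let ?D = "DIM('a)"
  let ?f = "\<lambda>(n::nat) z. ennreal ((cmod (char_fun \<mu> z))\<^sup>2 * exp (- (norm (z /\<^sub>R real (Suc n)))\<^sup>2 / 2))"
  interpret prob_space \<mu> by fact
  interpret G: prob_space "gauss_measure :: 'a measure" by (rule prob_space_gauss_measure)
  have sets[measurable_cong]: "sets \<mu> = sets borel" by (simp add: \<mu>)
  note [measurable] = borel_measurable_char_fun[OF \<open>prob_space \<mu>\<close> sets]
  have "0 \<le> C" using p[of 0] by linarith
  show "?f n \<in> borel_measurable lborel" for n by measurable
  show "ennreal ((cmod (char_fun \<mu> z))\<^sup>2) \<le> liminf (\<lambda>n. ?f n z)" for z
  proof -
    have "(\<lambda>n. inverse (real (Suc n)) *\<^sub>R z) \<longlonglongrightarrow> 0 *\<^sub>R z"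
      by (intro tendsto_scaleR LIMSEQ_inverse_real_of_nat tendsto_const)
    then have "(\<lambda>n. (cmod (char_fun \<mu> z))\<^sup>2 * exp (- (norm (z /\<^sub>R real (Suc n)))\<^sup>2 / 2)) \<longlonglongrightarrow>
        (cmod (char_fun \<mu> z))\<^sup>2 * exp (- (norm (0 *\<^sub>R z))\<^sup>2 / 2)"
      by (intro tendsto_mult tendsto_const tendsto_exp tendsto_divide tendsto_minus tendsto_power tendsto_norm) auto
    then have "(\<lambda>n. ?f n z) \<longlonglongrightarrow> ennreal ((cmod (char_fun \<mu> z))\<^sup>2)"
      by (intro tendsto_ennrealI) simp
    from lim_imp_Liminf[OF _ this] show ?thesis by simp
  qed
  show "(\<integral>\<^sup>+z. ?f n z \<partial>lborel) \<le> ennreal ((2 * pi) ^ ?D * C)" for n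
  proof -
    define s where "s = real (Suc n)"
    have s: "0 < s" by (simp add: s_def)
    have inner: "(\<integral>y. exp (- (norm (s *\<^sub>R (x - y)))\<^sup>2 / 2) \<partial>\<mu>) \<le> C * (sqrt (2 * pi) ^ ?D / s ^ ?D)" for x
    proof -
      have "ennreal (\<integral>y. exp (- (norm (s *\<^sub>R (x - y)))\<^sup>2 / 2) \<partial>\<mu>) =
          (\<integral>\<^sup>+y. ennreal (exp (- (norm (s *\<^sub>R (x - y)))\<^sup>2 / 2)) \<partial>\<mu>)"
        by (intro nn_integral_eq_integral[symmetric] integrable_const_bound[where B=1]) auto
      also have "\<dots> = (\<integral>\<^sup>+y. ennreal (p y) * ennreal (exp (- (norm (s *\<^sub>R (x - y)))\<^sup>2 / 2)) \<partial>lborel)"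
        unfolding \<mu> by (rule nn_integral_density) auto
      also have "\<dots> \<le> (\<integral>\<^sup>+y. ennreal C * ennreal (exp (- (norm (s *\<^sub>R (x - y)))\<^sup>2 / 2)) \<partial>lborel)"
        by (intro nn_integral_mono mult_right_mono ennreal_leI p) simp
      also have "\<dots> = ennreal (C * (sqrt (2 * pi) ^ ?D / s ^ ?D))"
        using \<open>0 \<le> C\<close> by (subst nn_integral_cmult) (simp_all only: nn_integral_exp_norm_sq[OF s], use s in \<open>simp_all flip: ennreal_mult'\<close>)
      finally show ?thesis using s \<open>0 \<le> C\<close> by (simp add: ennreal_le_iff)
    qed
    have "(\<integral>\<^sup>+z. ?f n z \<partial>lborel) = ennreal (\<bar>s\<bar> ^ ?D) * (\<integral>\<^sup>+w. ?f n (0 + s *\<^sub>R w) \<partial>lborel)"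
      using s by (intro nn_integral_lborel_affine) auto
    also have "(\<integral>\<^sup>+w. ?f n (0 + s *\<^sub>R w) \<partial>lborel) =
        (\<integral>\<^sup>+w. ennreal (sqrt (2 * pi) ^ ?D) * (ennreal (gauss w) * ennreal ((cmod (char_fun \<mu> (s *\<^sub>R w)))\<^sup>2)) \<partial>lborel)"
    proof (intro nn_integral_cong)
      fix w :: 'a
      have "(s *\<^sub>R w) /\<^sub>R real (Suc n) = w" using s by (simp add: s_def)
      then show "?f n (0 + s *\<^sub>R w) = ennreal (sqrt (2 * pi) ^ ?D) * (ennreal (gauss w) * ennreal ((cmod (char_fun \<mu> (s *\<^sub>R w)))\<^sup>2))"
        by (simp only: add_0) (simp add: gauss_eq mult.commute flip: ennreal_mult')
    qed
    also have "\<dots> = ennreal (sqrt (2 * pi) ^ ?D) * (\<integral>\<^sup>+w. ennreal ((cmod (char_fun \<mu> (s *\<^sub>R w)))\<^sup>2) \<partial>gauss_measure)"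
      unfolding gauss_measure_def by (simp add: nn_integral_cmult nn_integral_density)
    also have "(\<integral>\<^sup>+w. ennreal ((cmod (char_fun \<mu> (s *\<^sub>R w)))\<^sup>2) \<partial>gauss_measure) =
        ennreal (\<integral>w. (cmod (char_fun \<mu> (s *\<^sub>R w)))\<^sup>2 \<partial>gauss_measure)"
      by (intro nn_integral_eq_integral G.integrable_const_bound[where B=1])
         (auto simp: norm_char_fun_le[OF \<open>prob_space \<mu>\<close>] power_le_one)
    also have "(\<integral>w. (cmod (char_fun \<mu> (s *\<^sub>R w)))\<^sup>2 \<partial>gauss_measure) =
        (\<integral>x. (\<integral>y. exp (- (norm (s *\<^sub>R (x - y)))\<^sup>2 / 2) \<partial>\<mu>) \<partial>\<mu>)"
      by (rule gauss_smoothing_char_fun_sq[symmetric]) fact+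
    also have "\<dots> \<le> (\<integral>x. C * (sqrt (2 * pi) ^ ?D / s ^ ?D) \<partial>\<mu>)"
      using inner s \<open>0 \<le> C\<close> by (intro integral_mono' ) auto
    also have "\<dots> = C * (sqrt (2 * pi) ^ ?D / s ^ ?D)" by (simp add: prob_space)
    finally have "(\<integral>\<^sup>+z. ?f n z \<partial>lborel) \<le> ennreal (\<bar>s\<bar> ^ ?D) * (ennreal (sqrt (2 * pi) ^ ?D) * ennreal (C * (sqrt (2 * pi) ^ ?D / s ^ ?D)))"
      by (simp add: ennreal_leI mult_left_mono)
    also have "\<dots> = ennreal ((sqrt (2 * pi) * sqrt (2 * pi)) ^ ?D * C)"
      using s \<open>0 \<le> C\<close> by (simp add: power_mult_distrib flip: ennreal_mult' del: real_sqrt_mult_self)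
    finally show ?thesis by simp
  qed
qed

section \<open>Bounded densities from integrable characteristic functions\<close>

lemma measure_le_const_lborel:
  fixes \<mu> :: "'a::euclidean_space measure"
  assumes sets: "sets \<mu> = sets borel" and "0 \<le> c"
    and open_le: "\<And>U. open U \<Longrightarrow> emeasure \<mu> U \<le> ennreal c * emeasure lborel U"
    and B: "B \<in> sets borel"
  shows "emeasure \<mu> B \<le> ennreal c * emeasure lborel B"
proof (rule ennreal_le_epsilon)
  fix e :: real assume "0 < e" and fin: "ennreal c * emeasure lborel B < top"
  \<comment> \<open>The denominator c + 1 covers c = 0 and keeps c * (e / (c + 1)) below e.\<close>
  obtain U where U: "open U" "B \<subseteq> U" "emeasure lborel (U - B) < ennreal (e / (c + 1))"
    using outer_regular_lborel[of B "e / (c + 1)"] B \<open>0 < e\<close> \<open>0 \<le> c\<close> by auto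
  have "emeasure \<mu> B \<le> emeasure \<mu> U"
    using U by (intro emeasure_mono) (auto simp: sets)
  also have "\<dots> \<le> ennreal c * emeasure lborel (B \<union> (U - B))"
    using open_le[OF U(1)] U(2) by (simp add: Un_absorb1)
  also have "\<dots> = ennreal c * emeasure lborel B + ennreal c * emeasure lborel (U - B)"
    using B U by (subst plus_emeasure[symmetric]) (auto simp: distrib_left)
  also have "ennreal c * emeasure lborel (U - B) \<le> ennreal c * ennreal (e / (c + 1))"
    using U(3) by (intro mult_left_mono) auto
  also have "\<dots> \<le> ennreal e"
    using \<open>0 < e\<close> \<open>0 \<le> c\<close> by (subst ennreal_mult'[symmetric]) (auto intro!: ennreal_leI simp: field_simps)
  finally show "emeasure \<mu> B \<le> ennreal c * emeasure lborel B + ennreal e" by (simp add: add_left_mono)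
qed

text \<open>On the set where the Radon-Nikodym density exceeds c, its integral is at most c times
  the volume, so that set is null. Capping the density at c then yields a version bounded at every
  point rather than almost everywhere.\<close>

lemma bounded_density_exists:
  fixes \<mu> :: "'a::euclidean_space measure"
  assumes "prob_space \<mu>" and sets: "sets \<mu> = sets borel" and c: "0 < c"
    and le: "\<And>B. B \<in> sets borel \<Longrightarrow> emeasure \<mu> B \<le> ennreal c * emeasure lborel B"
  shows "\<exists>p. (\<forall>x. 0 \<le> p x) \<and> p \<in> borel_measurable lborel \<and> \<mu> = density lborel (\<lambda>x. ennreal (p x)) \<and> (\<forall>x. p x \<le> c)"
proof -
  interpret prob_space \<mu> by fact
  have "absolutely_continuous lborel \<mu>"
    unfolding absolutely_continuous_def
  proof
    fix B :: "'a set" assume "B \<in> null_sets lborel"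
    then show "B \<in> null_sets \<mu>" using le[of B] by (auto simp: null_sets_def sets)
  qed
  then obtain f where f[measurable]: "f \<in> borel_measurable borel" and f\<mu>: "density lborel f = \<mu>"
    using sigma_finite_measure.Radon_Nikodym[OF lborel.sigma_finite_measure_axioms, of \<mu>] sets by auto
  define B where "B = {x. ennreal c < f x}"
  have B[measurable]: "B \<in> sets borel" unfolding B_def by measurable
  have \<mu>B: "emeasure \<mu> B = (\<integral>\<^sup>+x. f x * indicator B x \<partial>lborel)"
    unfolding f\<mu>[symmetric] by (rule emeasure_density) auto
  have cB: "ennreal c * emeasure lborel B = (\<integral>\<^sup>+x. ennreal c * indicator B x \<partial>lborel)"
    by (simp add: nn_integral_cmult_indicator)
  \<comment> \<open>Integrals may be subtracted in \<open>ennreal\<close> only if the subtracted one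
    is finite; on \<open>B\<close> it is dominated by the finite measure
    \<open>\<mu>\<close>.\<close>
  have cfin: "(\<integral>\<^sup>+x. ennreal c * indicator B x \<partial>lborel) \<noteq> \<infinity>"
  proof -
    have "(\<integral>\<^sup>+x. ennreal c * indicator B x \<partial>lborel) \<le> emeasure \<mu> B"
      unfolding \<mu>B by (intro nn_integral_mono) (auto simp: B_def indicator_def)
    then show ?thesis using emeasure_finite[of B] by (auto simp: top_unique)
  qed
  have "AE x in lborel. f x \<le> ennreal c"
  proof -
    have "(\<integral>\<^sup>+x. (f x * indicator B x - ennreal c * indicator B x) \<partial>lborel) =
       (\<integral>\<^sup>+x. f x * indicator B x \<partial>lborel) - (\<integral>\<^sup>+x. ennreal c * indicator B x \<partial>lborel)"
      using cfin by (intro nn_integral_diff) (auto simp: B_def indicator_def)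
    also have "\<dots> = 0" using le[OF B] emeasure_finite[of B] unfolding \<mu>B cB by (simp add: diff_eq_0_iff_ennreal less_top)
    finally have "AE x in lborel. f x * indicator B x - ennreal c * indicator B x = 0"
      by (subst (asm) nn_integral_0_iff_AE) auto
    then show ?thesis
    proof eventually_elim
      case (elim x)
      then show ?case by (cases "x \<in> B") (auto simp: diff_eq_0_iff_ennreal B_def)
    qed
  qed
  define p where "p x = min c (enn2real (f x))" for x
  have "density lborel (\<lambda>x. ennreal (p x)) = density lborel f"
  proof (rule density_cong)
    show "AE x in lborel. ennreal (p x) = f x"
      using \<open>AE x in lborel. f x \<le> ennreal c\<close>
    proof eventually_elim
      case (elim x)
      then have "f x < top" using ennreal_less_top le_less_trans by blast
      moreover have "enn2real (f x) \<le> c" using elim c by (simp add: enn2real_leI)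
      ultimately show ?case by (simp add: p_def min_def)
    qed
  qed (auto simp: p_def)
  then show ?thesis
    using c by (intro exI[of _ p]) (auto simp: f\<mu> p_def[abs_def])
qed

text \<open>Smoothing by a centred Gaussian of variance \<open>1 / s\<^sup>2\<close> gives densities bounded by the same constant for
  every \<open>s\<close>; Fatou's lemma transfers the resulting bound on open sets to \<open>\<mu>\<close>.\<close>

lemma bounded_density_of_integrable_char_fun:
  fixes \<mu> :: "'a::euclidean_space measure"
  assumes "prob_space \<mu>" and sets[measurable_cong]: "sets \<mu> = sets borel" and C: "0 < C"
    and int: "(\<integral>\<^sup>+z. ennreal (cmod (char_fun \<mu> z)) \<partial>lborel) \<le> ennreal C"
  shows "\<exists>p. (\<forall>x. 0 \<le> p x) \<and> p \<in> borel_measurable lborel \<and> \<mu> = density lborel (\<lambda>x. ennreal (p x))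
    \<and> (\<forall>x. p x \<le> C / (2 * pi) ^ DIM('a))"
proof (rule bounded_density_exists)
  let ?D = "DIM('a)" and ?k = "sqrt (2 * pi) ^ DIM('a)"
  have k: "0 < ?k" by simp
  have kk: "?k * ?k = (2 * pi) ^ ?D" by (subst power_mult_distrib[symmetric]) simp
  interpret prob_space \<mu> by fact
  interpret G: prob_space "gauss_measure :: 'a measure" by (rule prob_space_gauss_measure)
  interpret P: pair_prob_space \<mu> "gauss_measure :: 'a measure" ..
  interpret PL: pair_sigma_finite \<mu> "lborel :: 'a measure" ..
  note [measurable] = borel_measurable_char_fun[OF assms(1,2)]
  have smooth: "(\<integral>\<^sup>+y. ennreal (gauss (s *\<^sub>R (x - y))) \<partial>\<mu>) \<le> ennreal (C / (s ^ ?D * (2 * pi) ^ ?D))" if s: "0 < s" for s x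
  proof -
    have "(\<integral>y. exp (- (norm (s *\<^sub>R (x - y)))\<^sup>2 / 2) \<partial>\<mu>) \<le>
       cmod (complex_of_real (\<integral>y. exp (- (norm (s *\<^sub>R (x - y)))\<^sup>2 / 2) \<partial>\<mu>))"
      by simp
    also have "\<dots> \<le> (\<integral>w. cmod (exp (\<i> * complex_of_real ((s *\<^sub>R w) \<bullet> x)) * char_fun \<mu> (- (s *\<^sub>R w))) \<partial>gauss_measure)"
      unfolding gauss_smoothing_char_fun[OF assms(1,2)] by (rule integral_norm_bound)
    also have "\<dots> = (\<integral>w. cmod (char_fun \<mu> ((- s) *\<^sub>R w)) \<partial>gauss_measure)"
      by (simp add: norm_mult)
    finally have "ennreal (\<integral>y. exp (- (norm (s *\<^sub>R (x - y)))\<^sup>2 / 2) \<partial>\<mu>) \<le> ennreal (\<integral>w. cmod (char_fun \<mu> ((- s) *\<^sub>R w)) \<partial>gauss_measure)"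
      by (rule ennreal_leI)
    also have "\<dots> = (\<integral>\<^sup>+w. ennreal (cmod (char_fun \<mu> ((- s) *\<^sub>R w))) \<partial>gauss_measure)"
      by (intro nn_integral_eq_integral[symmetric] G.integrable_const_bound[where B=1])
         (auto simp: norm_char_fun_le[OF \<open>prob_space \<mu>\<close>])
    also have "\<dots> = (\<integral>\<^sup>+w. ennreal (gauss w) * ennreal (cmod (char_fun \<mu> ((- s) *\<^sub>R w))) \<partial>lborel)"
      unfolding gauss_measure_def by (rule nn_integral_density) auto
    also have "\<dots> \<le> (\<integral>\<^sup>+w. ennreal (1 / ?k) * ennreal (cmod (char_fun \<mu> ((- s) *\<^sub>R w))) \<partial>lborel)"
      by (intro nn_integral_mono mult_right_mono ennreal_leI gauss_le) auto
    also have "\<dots> = ennreal (1 / ?k) * (\<integral>\<^sup>+w. ennreal (cmod (char_fun \<mu> ((- s) *\<^sub>R w))) \<partial>lborel)"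
      by (rule nn_integral_cmult) auto
    also have "(\<integral>\<^sup>+w. ennreal (cmod (char_fun \<mu> ((- s) *\<^sub>R w))) \<partial>lborel) =
       ennreal (1 / s ^ ?D) * (ennreal (\<bar>- s\<bar> ^ ?D) * (\<integral>\<^sup>+w. ennreal (cmod (char_fun \<mu> (0 + (- s) *\<^sub>R w))) \<partial>lborel))"
      using s by (simp add: mult.assoc[symmetric] ennreal_mult'[symmetric])
    also have "ennreal (\<bar>- s\<bar> ^ ?D) * (\<integral>\<^sup>+w. ennreal (cmod (char_fun \<mu> (0 + (- s) *\<^sub>R w))) \<partial>lborel) =
        (\<integral>\<^sup>+z. ennreal (cmod (char_fun \<mu> z)) \<partial>lborel)"
      using s by (intro nn_integral_lborel_affine[symmetric]) auto
    also have "ennreal (1 / ?k) * (ennreal (1 / s ^ ?D) * \<dots>) \<le> ennreal (1 / ?k) * (ennreal (1 / s ^ ?D) * ennreal C)"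
      by (intro mult_left_mono int) auto
    finally have *: "ennreal (\<integral>y. exp (- (norm (s *\<^sub>R (x - y)))\<^sup>2 / 2) \<partial>\<mu>) \<le> ennreal (1 / ?k) * (ennreal (1 / s ^ ?D) * ennreal C)" .
    have "(\<integral>\<^sup>+y. ennreal (gauss (s *\<^sub>R (x - y))) \<partial>\<mu>) = (\<integral>\<^sup>+y. ennreal (1 / ?k) * ennreal (exp (- (norm (s *\<^sub>R (x - y)))\<^sup>2 / 2)) \<partial>\<mu>)"
      by (simp add: gauss_eq flip: ennreal_mult')
    also have "\<dots> = ennreal (1 / ?k) * (\<integral>\<^sup>+y. ennreal (exp (- (norm (s *\<^sub>R (x - y)))\<^sup>2 / 2)) \<partial>\<mu>)"
      by (rule nn_integral_cmult) auto
    also have "(\<integral>\<^sup>+y. ennreal (exp (- (norm (s *\<^sub>R (x - y)))\<^sup>2 / 2)) \<partial>\<mu>) = ennreal (\<integral>y. exp (- (norm (s *\<^sub>R (x - y)))\<^sup>2 / 2) \<partial>\<mu>)"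
      by (intro nn_integral_eq_integral integrable_const_bound[where B=1]) auto
    also have "ennreal (1 / ?k) * \<dots> \<le> ennreal (1 / ?k) * (ennreal (1 / ?k) * (ennreal (1 / s ^ ?D) * ennreal C))"
      by (intro mult_left_mono *) auto
    also have "\<dots> = ennreal (C / (s ^ ?D * (2 * pi) ^ ?D))"
      unfolding kk[symmetric] using s C k by (simp add: divide_simps flip: ennreal_mult')
    finally show ?thesis .
  qed
  have open_le: "emeasure \<mu> U \<le> ennreal (C / (2 * pi) ^ ?D) * emeasure lborel U" if U: "open U" for U
  proof -
    have [measurable]: "U \<in> sets borel" using U by simp
    \<comment> \<open>A Gaussian w independent of y is introduced so that the limit can be taken
      pointwise on pairs: since U is open, y + w / (n + 1) lies in U for all large n whenever y
      does.\<close>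
    have "emeasure \<mu> U = (\<integral>\<^sup>+y. (\<integral>\<^sup>+w. indicator U y \<partial>(gauss_measure :: 'a measure)) \<partial>\<mu>)"
      using G.emeasure_space_1 by simp
    also have "\<dots> = (\<integral>\<^sup>+z. indicator U (fst z) \<partial>(\<mu> \<Otimes>\<^sub>M (gauss_measure :: 'a measure)))"
      by (subst G.nn_integral_fst[symmetric]) auto
    also have "\<dots> \<le> ennreal (C / (2 * pi) ^ ?D) * emeasure lborel U"
    proof (rule nn_integral_fatou_le)
      let ?f = "\<lambda>(n::nat) (z :: 'a \<times> 'a). indicator U (fst z + snd z /\<^sub>R real (Suc n)) :: ennreal"
      show "?f n \<in> borel_measurable (\<mu> \<Otimes>\<^sub>M gauss_measure)" for n by measurable
      show "indicator U (fst z) \<le> liminf (\<lambda>n. ?f n z)" for z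
      proof (cases "fst z \<in> U")
        case True
        have "(\<lambda>n. fst z + inverse (real (Suc n)) *\<^sub>R snd z) \<longlonglongrightarrow> fst z + 0 *\<^sub>R snd z"
          by (intro tendsto_intros LIMSEQ_inverse_real_of_nat)
        then have "\<forall>\<^sub>F n in sequentially. fst z + inverse (real (Suc n)) *\<^sub>R snd z \<in> U"
          using topological_tendstoD[OF _ U, of _ "fst z"] True by simp
        then have "\<forall>\<^sub>F n in sequentially. 1 \<le> ?f n z" by eventually_elim simp
        then have "1 \<le> liminf (\<lambda>n. ?f n z)" by (intro Liminf_bounded) auto
        then show ?thesis using True by simp
      qed simp
      show "(\<integral>\<^sup>+z. ?f n z \<partial>(\<mu> \<Otimes>\<^sub>M gauss_measure)) \<le> ennreal (C / (2 * pi) ^ ?D) * emeasure lborel U" for n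
      proof -
        define s where "s = real (Suc n)"
        have s: "0 < s" by (simp add: s_def)
        have inner: "(\<integral>\<^sup>+w. ?f n (y, w) \<partial>gauss_measure) =
           ennreal (s ^ ?D) * (\<integral>\<^sup>+x. ennreal (gauss (s *\<^sub>R (x - y))) * indicator U x \<partial>lborel)" for y
        proof -
          have "(\<integral>\<^sup>+x. ennreal (gauss (s *\<^sub>R (x - y))) * indicator U x \<partial>lborel) =
            ennreal (\<bar>1 / s\<bar> ^ ?D) * (\<integral>\<^sup>+w. ennreal (gauss (s *\<^sub>R (y + (1 / s) *\<^sub>R w - y))) * indicator U (y + (1 / s) *\<^sub>R w) \<partial>lborel)"
            using s by (intro nn_integral_lborel_affine) auto
          also have "\<dots> = ennreal (\<bar>1 / s\<bar> ^ ?D) * (\<integral>\<^sup>+w. ennreal (gauss w) * ?f n (y, w) \<partial>lborel)"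
            using s by (simp add: s_def inverse_eq_divide)
          also have "(\<integral>\<^sup>+w. ennreal (gauss w) * ?f n (y, w) \<partial>lborel) = (\<integral>\<^sup>+w. ?f n (y, w) \<partial>gauss_measure)"
            unfolding gauss_measure_def by (rule nn_integral_density[symmetric]) auto
          finally show ?thesis
            using s by (simp add: mult.assoc[symmetric] ennreal_mult'[symmetric] power_one_over)
        qed
        have "(\<integral>\<^sup>+z. ?f n z \<partial>(\<mu> \<Otimes>\<^sub>M gauss_measure)) = (\<integral>\<^sup>+y. (\<integral>\<^sup>+w. ?f n (y, w) \<partial>gauss_measure) \<partial>\<mu>)"
          by (rule G.nn_integral_fst[symmetric]) measurable
        also have "\<dots> = ennreal (s ^ ?D) * (\<integral>\<^sup>+y. (\<integral>\<^sup>+x. ennreal (gauss (s *\<^sub>R (x - y))) * indicator U x \<partial>lborel) \<partial>\<mu>)"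
          unfolding inner by (rule nn_integral_cmult) measurable
        also have "(\<integral>\<^sup>+y. (\<integral>\<^sup>+x. ennreal (gauss (s *\<^sub>R (x - y))) * indicator U x \<partial>lborel) \<partial>\<mu>) =
            (\<integral>\<^sup>+x. (\<integral>\<^sup>+y. ennreal (gauss (s *\<^sub>R (x - y))) * indicator U x \<partial>\<mu>) \<partial>lborel)"
          by (rule PL.Fubini'[symmetric]) measurable
        also have "\<dots> = (\<integral>\<^sup>+x. (\<integral>\<^sup>+y. ennreal (gauss (s *\<^sub>R (x - y))) \<partial>\<mu>) * indicator U x \<partial>lborel)"
          by (intro nn_integral_cong nn_integral_multc) measurable
        also have "\<dots> \<le> (\<integral>\<^sup>+x. ennreal (C / (s ^ ?D * (2 * pi) ^ ?D)) * indicator U x \<partial>lborel)"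
          by (intro nn_integral_mono mult_right_mono smooth s) auto
        also have "\<dots> = ennreal (C / (s ^ ?D * (2 * pi) ^ ?D)) * emeasure lborel U"
          by (rule nn_integral_cmult_indicator) simp
        finally have "(\<integral>\<^sup>+z. ?f n z \<partial>(\<mu> \<Otimes>\<^sub>M gauss_measure)) \<le>
            ennreal (s ^ ?D) * (ennreal (C / (s ^ ?D * (2 * pi) ^ ?D)) * emeasure lborel U)"
          by (simp add: mult_left_mono)
        also have "\<dots> = ennreal (C / (2 * pi) ^ ?D) * emeasure lborel U"
          using s C by (simp add: mult.assoc[symmetric] ennreal_mult'[symmetric])
        finally show ?thesis .
      qed
    qed
    finally show ?thesis .
  qed
  show "emeasure \<mu> B \<le> ennreal (C / (2 * pi) ^ ?D) * emeasure lborel B" if "B \<in> sets borel" for B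
    using C by (intro measure_le_const_lborel[OF sets _ open_le that]) auto
qed (use assms in auto)

section \<open>Elementary inequalities\<close>

lemma cos_quadratic_bound: "1 - cos s \<le> 2 * min 1 ((s::real)\<^sup>2)"
proof -
  have "1 - cos s = 2 * (sin (s / 2))\<^sup>2"
    using cos_double_sin[of "s / 2"] by simp
  moreover have "4 * (sin (s / 2))\<^sup>2 \<le> s\<^sup>2"
    using power_mono[OF abs_sin_x_le_abs_x[of "s / 2"], of 2] by (simp add: power_divide)
  moreover have "(sin (s / 2))\<^sup>2 \<le> 1" by (simp add: abs_square_le_1)
  ultimately have "1 - cos s \<le> 2 * 1" "1 - cos s \<le> 2 * s\<^sup>2"
    using zero_le_power2[of s] zero_le_power2[of "sin (s / 2)"] by linarith+
  then show ?thesis by (simp add: min_def)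
qed

text \<open>The third-order Taylor error is at most s^4 / 24, so for |s| \<le> 1 at least 11/24 of
  s^2 remains, more than the quarter claimed.\<close>

lemma cos_quadratic_lower:
  assumes "\<bar>s::real\<bar> \<le> 1"
  shows "s\<^sup>2 \<le> 4 * (1 - cos s)"
proof -
  have "\<bar>Re (iexp s - (\<Sum>k\<le>3. (\<i> * complex_of_real s) ^ k / fact k))\<bar> \<le> \<bar>s\<bar> ^ 4 / fact 4"
    using order_trans[OF abs_Re_le_cmod iexp_approx1[of s 3]] by (simp add: numeral_eq_Suc)
  moreover have "Re (iexp s - (\<Sum>k\<le>3. (\<i> * complex_of_real s) ^ k / fact k)) = cos s - 1 + s\<^sup>2 / 2"
    by (simp add: numeral_eq_Suc Re_exp)
  ultimately have "\<bar>cos s - 1 + s\<^sup>2 / 2\<bar> \<le> \<bar>s\<bar> ^ 4 / fact 4" by (simp only:)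
  moreover have "\<bar>s\<bar> ^ 4 / fact 4 \<le> s\<^sup>2 / 24"
  proof -
    have "\<bar>s\<bar> ^ 4 \<le> \<bar>s\<bar>\<^sup>2" using assms by (intro power_decreasing) auto
    then show ?thesis by (simp add: fact_numeral)
  qed
  ultimately have "\<bar>cos s - 1 + s\<^sup>2 / 2\<bar> \<le> s\<^sup>2 / 24" by (rule order_trans)
  then show ?thesis using zero_le_power2[of s] unfolding abs_le_iff by argo
qed

text \<open>1 - sin s / s is the mean of 1 - cos (u s) over u in [0, 1] and, unlike 1 - cos s, stays
  away from 0 for large s. Up to |s| = 2 Taylor expansion leaves at least 2/15 of s^2; beyond that
  sin s / s is at most 1/2.\<close>

lemma sinc_quadratic_bound:
  assumes "(s::real) \<noteq> 0"
  shows "min 1 (s\<^sup>2) \<le> 8 * (1 - sin s / s)"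
proof (cases "\<bar>s\<bar> \<le> 2")
  case True
  have "\<bar>Im (iexp s - (\<Sum>k\<le>4. (\<i> * complex_of_real s) ^ k / fact k))\<bar> \<le> \<bar>s\<bar> ^ 5 / fact 5"
    using order_trans[OF abs_Im_le_cmod iexp_approx1[of s 4]] by (simp add: numeral_eq_Suc)
  moreover have "Im (iexp s - (\<Sum>k\<le>4. (\<i> * complex_of_real s) ^ k / fact k)) = sin s - s + s ^ 3 / 6"
    by (simp add: numeral_eq_Suc Im_exp)
  ultimately have "\<bar>sin s - s + s ^ 3 / 6\<bar> \<le> \<bar>s\<bar> ^ 5 / 120" by (simp add: fact_numeral)
  then have "\<bar>(sin s - s + s ^ 3 / 6) / s\<bar> \<le> \<bar>s\<bar> ^ 5 / 120 / \<bar>s\<bar>"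
    unfolding abs_divide by (intro divide_right_mono) auto
  also have "(sin s - s + s ^ 3 / 6) / s = sin s / s - 1 + s\<^sup>2 / 6"
    using assms by (simp add: field_simps power2_eq_square power3_eq_cube)
  also have "\<bar>s\<bar> ^ 5 / 120 / \<bar>s\<bar> = s\<^sup>2 * s\<^sup>2 / 120"
    using assms by (simp add: numeral_eq_Suc abs_mult[symmetric])
  finally have "\<bar>sin s / s - 1 + s\<^sup>2 / 6\<bar> \<le> s\<^sup>2 * s\<^sup>2 / 120" .
  moreover have "s\<^sup>2 \<le> 4" using abs_le_square_iff[of s 2] True by simp
  then have "s\<^sup>2 * s\<^sup>2 \<le> 4 * s\<^sup>2" by (intro mult_right_mono) auto
  ultimately have "sin s / s \<le> 1 - s\<^sup>2 / 8" using zero_le_power2[of s] unfolding abs_le_iff by argo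
  then show ?thesis by (simp add: min.coboundedI2)
next
  case False
  have "sin s / s \<le> \<bar>sin s\<bar> / \<bar>s\<bar>" by (metis abs_divide abs_ge_self)
  also have "\<dots> \<le> 1 / 2" using False by (intro frac_le) auto
  finally have "1 \<le> 8 * (1 - sin s / s)" by argo
  then show ?thesis by (simp add: min.coboundedI1)
qed

lemma nn_integral_one_minus_cos:
  "ennreal (min 1 (s\<^sup>2)) \<le> ennreal 8 * (\<integral>\<^sup>+u. ennreal (1 - cos (u * s)) * indicator {0..1} u \<partial>lborel)"
proof (cases "s = 0")
  case False
  have "(\<integral>\<^sup>+u. ennreal (1 - cos (u * s)) * indicator {0..1} u \<partial>lborel) =
     ennreal ((1 - sin (1 * s) / s) - (0 - sin (0 * s) / s))"
    using False by (intro nn_integral_FTC_Icc) (auto intro!: derivative_eq_intros)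
  then show ?thesis
    using ennreal_leI[OF sinc_quadratic_bound[OF False]] unfolding ennreal_mult'[OF zero_le_numeral] by simp
qed simp

text \<open>By the half-angle formula this is the square of |sin (k u)| \<le> k |sin u|.\<close>

lemma one_minus_cos_mult: "1 - cos (real k * s) \<le> (real k)\<^sup>2 * (1 - cos s)"
proof -
  have *: "\<bar>sin (real k * u)\<bar> \<le> real k * \<bar>sin u\<bar>" for u
  proof (induction k)
    case (Suc k)
    have "\<bar>sin (real (Suc k) * u)\<bar> \<le> \<bar>sin (real k * u) * cos u\<bar> + \<bar>cos (real k * u) * sin u\<bar>"
      by (simp add: algebra_simps sin_add)
    also have "\<dots> \<le> \<bar>sin (real k * u)\<bar> + \<bar>sin u\<bar>"
      unfolding abs_mult by (intro add_mono mult_left_le mult_left_le_one_le) auto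
    finally show ?case using Suc by (simp add: algebra_simps)
  qed simp
  have "(sin (real k * (s / 2)))\<^sup>2 \<le> (real k * \<bar>sin (s / 2)\<bar>)\<^sup>2"
    using power_mono[OF *[of "s / 2"], of 2] by simp
  then show ?thesis
    using cos_double_sin[of "real k * (s / 2)"] cos_double_sin[of "s / 2"]
    by (simp add: power_mult_distrib)
qed

lemma one_minus_cos_add: "1 - cos (a + b) \<le> 2 * (1 - cos a) + 2 * (1 - cos (b::real))"
proof -
  have "\<bar>sin (a / 2 + b / 2)\<bar> \<le> \<bar>sin (a / 2) * cos (b / 2)\<bar> + \<bar>cos (a / 2) * sin (b / 2)\<bar>"
    by (simp add: sin_add)
  also have "\<dots> \<le> \<bar>sin (a / 2)\<bar> + \<bar>sin (b / 2)\<bar>"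
    unfolding abs_mult by (intro add_mono mult_left_le mult_left_le_one_le) auto
  finally have "\<bar>sin (a / 2 + b / 2)\<bar>\<^sup>2 \<le> (\<bar>sin (a / 2)\<bar> + \<bar>sin (b / 2)\<bar>)\<^sup>2"
    by (intro power_mono) auto
  also have "\<dots> \<le> 2 * (sin (a / 2))\<^sup>2 + 2 * (sin (b / 2))\<^sup>2"
    using sum_squares_bound[of "\<bar>sin (a / 2)\<bar>" "\<bar>sin (b / 2)\<bar>"] by (simp add: power2_sum)
  finally show ?thesis
    using cos_double_sin[of "a / 2 + b / 2"] cos_double_sin[of "a / 2"] cos_double_sin[of "b / 2"] by simp
qed

lemma min_one_mult_le:
  fixes a u :: real
  assumes "0 \<le> a" "0 \<le> u"
  shows "min 1 (a * u) \<le> (1 + a) * min 1 u"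
proof (cases "u \<le> 1")
  case True
  then show ?thesis using assms by (simp add: min_def algebra_simps)
next
  case False
  then show ?thesis using assms by simp
qed

lemma min_one_sum_le:
  fixes f :: "'i \<Rightarrow> real"
  assumes "finite I" "\<And>i. i \<in> I \<Longrightarrow> 0 \<le> f i"
  shows "min 1 (\<Sum>i\<in>I. f i) \<le> (\<Sum>i\<in>I. min 1 (f i))"
  using assms
proof (induction I rule: finite_induct)
  case (insert i I)
  have "0 \<le> f i" "0 \<le> sum f I" using insert.prems by (auto intro: sum_nonneg)
  then have "min 1 (f i + sum f I) \<le> min 1 (f i) + min 1 (sum f I)" by linarith
  also have "min 1 (sum f I) \<le> (\<Sum>i\<in>I. min 1 (f i))" using insert.prems by (intro insert.IH) auto
  finally show ?case using insert.hyps by simp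
qed simp

lemma summable_stretched_exp:
  fixes a \<alpha> D :: real
  assumes "0 < a" "0 < \<alpha>"
  shows "summable (\<lambda>n::nat. (real n + 1) powr D * exp (- a * real n powr \<alpha>))"
proof (rule summable_comparison_test_bigo)
  show "summable (\<lambda>n. norm (real n powr (- 2)))" by (simp add: summable_real_powr_iff)
  show "(\<lambda>n::nat. (real n + 1) powr D * exp (- a * real n powr \<alpha>)) \<in> O(\<lambda>n. real n powr (- 2))"
    using assms by real_asymp
qed

lemma eventually_exp_beats_powr:
  fixes c k \<delta> :: real
  assumes "0 < c" "0 < k" "0 < \<delta>"
  shows "eventually (\<lambda>t. exp (- (\<delta> * t)) * (c * t) powr k \<le> 1) at_top"
proof -
  have "((\<lambda>t. exp (- (\<delta> * t)) * (c * t) powr k) \<longlongrightarrow> 0) at_top"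
    using assms by real_asymp
  from order_tendstoD(2)[OF this, of 1] show ?thesis by (auto elim: eventually_mono)
qed

text \<open>The shell n \<le> |z| r < n + 1 lies in a ball of volume proportional to ((n + 1) /
  r)^d. The power of r factors out of every term and a convergent series remains, so
  \<open>J\<close> does not depend on r.\<close>

lemma nn_integral_stretched_exp_le:
  fixes a \<alpha> :: real
  assumes a: "0 < a" "0 < \<alpha>"
  obtains J where "0 < J"
    "\<And>r. 0 < r \<Longrightarrow> (\<integral>\<^sup>+z. ennreal (exp (- a * (norm (z::'a::euclidean_space) * r) powr \<alpha>)) \<partial>lborel) \<le> ennreal (J * r powr (- real DIM('a)))"
proof -
  let ?D = "DIM('a)"
  define V where "V = unit_ball_vol (real ?D)"
  have V: "0 < V" by (simp add: V_def)
  define f where "f n = (real n + 1) powr real ?D * exp (- a * real n powr \<alpha>)" for n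
  have f: "summable f" "\<And>n. 0 \<le> f n"
    unfolding f_def[abs_def] using summable_stretched_exp[OF a, of "real ?D"] by simp_all
  define J where "J = V * suminf f"
  have "0 < f 0" using a by (simp add: f_def)
  then have "0 < suminf f" using f by (intro suminf_pos2[of f 0]) auto
  then have J: "0 < J" using V by (simp add: J_def)
  have "(\<integral>\<^sup>+z. ennreal (exp (- a * (norm (z::'a) * r) powr \<alpha>)) \<partial>lborel) \<le> ennreal (J * r powr (- real ?D))" if r: "0 < r" for r
  proof -
    let ?B = "\<lambda>n. ball (0::'a) ((real n + 1) / r)"
    let ?g = "\<lambda>n z. ennreal (exp (- a * real n powr \<alpha>)) * indicator (?B n) z"
    have "(\<integral>\<^sup>+z. ennreal (exp (- a * (norm (z::'a) * r) powr \<alpha>)) \<partial>lborel) \<le> (\<integral>\<^sup>+z. (\<Sum>n. ?g n z) \<partial>lborel)"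
    proof (rule nn_integral_mono)
      fix z :: 'a
      define n where "n = nat \<lfloor>norm z * r\<rfloor>"
      have n: "real n \<le> norm z * r" "norm z * r < real n + 1"
        using r by (auto simp: n_def)
      then have "z \<in> ?B n" using r by (simp add: field_simps)
      then have "ennreal (exp (- a * (norm z * r) powr \<alpha>)) \<le> ?g n z"
        using n a by (auto intro!: ennreal_leI powr_mono2)
      also have "\<dots> \<le> (\<Sum>n. ?g n z)"
      proof -
        have "F n \<le> suminf F" for F :: "nat \<Rightarrow> ennreal" using sum_le_suminf[of F "{n}"] by simp
        from this[of "\<lambda>n. ?g n z"] show ?thesis .
      qed
      finally show "ennreal (exp (- a * (norm z * r) powr \<alpha>)) \<le> (\<Sum>n. ?g n z)" .
    qed
    also have "\<dots> = (\<Sum>n. \<integral>\<^sup>+z. ?g n z \<partial>lborel)"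
      by (intro nn_integral_suminf borel_measurable_times_ennreal borel_measurable_const borel_measurable_indicator) simp
    also have "\<dots> = (\<Sum>n. ennreal (V * r powr (- real ?D) * f n))"
    proof (rule suminf_cong)
      fix n :: nat
      have "(\<integral>\<^sup>+z. ?g n z \<partial>lborel) = ennreal (exp (- a * real n powr \<alpha>)) * ennreal (V * ((real n + 1) / r) ^ ?D)"
        using r by (subst nn_integral_cmult_indicator) (auto simp: emeasure_ball V_def)
      also have "\<dots> = ennreal (exp (- a * real n powr \<alpha>) * (V * ((real n + 1) / r) ^ ?D))"
        by (rule ennreal_mult'[symmetric]) simp
      also have "((real n + 1) / r) ^ ?D = (real n + 1) powr real ?D * r powr (- real ?D)"
        using r by (simp add: powr_minus powr_realpow divide_inverse power_mult_distrib power_inverse)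
      finally show "(\<integral>\<^sup>+z. ?g n z \<partial>lborel) = ennreal (V * r powr (- real ?D) * f n)"
        by (simp add: f_def mult_ac)
    qed
    also have "\<dots> = ennreal (\<Sum>n. V * r powr (- real ?D) * f n)"
      using V f by (intro suminf_ennreal2 summable_mult) auto
    also have "(\<Sum>n. V * r powr (- real ?D) * f n) = J * r powr (- real ?D)"
      using f by (subst suminf_mult) (auto simp: J_def)
    finally show ?thesis .
  qed
  with J show thesis by (rule that)
qed

section \<open>The concentration function\<close>

locale levy_triplet =
  fixes A :: "real^'d^'d" and N :: "(real^'d) measure" and b :: "real^'d"
  assumes A: "sym_nonneg_matrix A" and N: "levy_measure N"
begin

lemma sets_N [measurable_cong, simp]: "sets N = sets borel"
  using N by (simp add: levy_measure_def)

lemma space_N [simp]: "space N = UNIV"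
  using sets_eq_imp_space_eq[OF sets_N] by simp

lemma AE_N_nonzero: "AE z in N. z \<noteq> 0"
  using N by (intro AE_I[where N="{0}"]) (auto simp: levy_measure_def)

lemma A_nonneg: "0 \<le> x \<bullet> (A *v x)"
  using A by (simp add: sym_nonneg_matrix_def)

lemma A_sym: "x \<bullet> (A *v y) = y \<bullet> (A *v x)"
  using A by (metis dot_lmul_matrix inner_commute sym_nonneg_matrix_def transpose_matrix_vector)

lemma integrable_min_one_norm: "integrable N (\<lambda>z. min 1 ((norm z)\<^sup>2))"
  using N by (intro integrableI_bounded) (auto simp: levy_measure_def)

lemma integrable_levy_bound:
  fixes f :: "real^'d \<Rightarrow> 'c::{banach, second_countable_topology}"
  assumes [measurable]: "f \<in> borel_measurable borel"
    and "\<And>z. norm (f z) \<le> K * min 1 ((norm z)\<^sup>2)"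
  shows "integrable N f"
proof (rule Bochner_Integration.integrable_bound)
  show "integrable N (\<lambda>z. K * min 1 ((norm z)\<^sup>2))"
    by (intro integrable_mult_right integrable_min_one_norm)
  have "norm (f z) \<le> norm (K * min 1 ((norm z)\<^sup>2))" for z
    using assms(2)[of z] abs_ge_self[of "K * min 1 ((norm z)\<^sup>2)"] by simp
  then show "AE z in N. norm (f z) \<le> norm (K * min 1 ((norm z)\<^sup>2))" by simp
qed measurable

lemma min_inner_sq_le: "min 1 ((x \<bullet> z)\<^sup>2) \<le> (1 + (norm x)\<^sup>2) * min 1 ((norm (z::real^'d))\<^sup>2)"
proof -
  have "(x \<bullet> z)\<^sup>2 \<le> (norm x)\<^sup>2 * (norm z)\<^sup>2"
    using power_mono[OF Cauchy_Schwarz_ineq2[of x z], of 2] by (simp add: power_mult_distrib)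
  then have "min 1 ((x \<bullet> z)\<^sup>2) \<le> min 1 ((norm x)\<^sup>2 * (norm z)\<^sup>2)" by simp
  also have "\<dots> \<le> (1 + (norm x)\<^sup>2) * min 1 ((norm z)\<^sup>2)" by (rule min_one_mult_le) auto
  finally show ?thesis .
qed

lemma integrable_min_inner: "integrable N (\<lambda>z. min 1 ((x \<bullet> z)\<^sup>2))"
  by (rule integrable_levy_bound[where K="1 + (norm x)\<^sup>2"]) (auto simp: min_inner_sq_le)

lemma integrable_one_minus_cos: "integrable N (\<lambda>z. 1 - cos (x \<bullet> z))"
proof (rule integrable_levy_bound[where K="2 * (1 + (norm x)\<^sup>2)"])
  show "norm (1 - cos (x \<bullet> z)) \<le> 2 * (1 + (norm x)\<^sup>2) * min 1 ((norm z)\<^sup>2)" for z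
    using cos_quadratic_bound[of "x \<bullet> z"] min_inner_sq_le[of x z] cos_le_one[of "x \<bullet> z"]
    unfolding real_norm_def mult.assoc by linarith
qed measurable

lemma integrable_trunc_sq: "integrable N (\<lambda>z. indicator {z. \<bar>x \<bullet> z\<bar> < 1} z * (x \<bullet> z)\<^sup>2)"
proof (rule Bochner_Integration.integrable_bound[OF integrable_min_inner[of x]])
  show "AE z in N. norm (indicator {z. \<bar>x \<bullet> z\<bar> < 1} z * (x \<bullet> z)\<^sup>2) \<le> norm (min 1 ((x \<bullet> z)\<^sup>2))"
    by (auto simp: indicator_def abs_square_le_1)
qed measurable

lemma integrable_h: "0 < r \<Longrightarrow> integrable N (\<lambda>z. min 1 ((norm z)\<^sup>2 / r\<^sup>2))"
proof (rule integrable_levy_bound[where K="1 + 1 / r\<^sup>2"])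
  show "norm (min 1 ((norm z)\<^sup>2 / r\<^sup>2)) \<le> (1 + 1 / r\<^sup>2) * min 1 ((norm z)\<^sup>2)" for z :: "real^'d"
    using min_one_mult_le[of "1 / r\<^sup>2" "(norm z)\<^sup>2"] by simp
qed measurable

section \<open>The real part of the exponent and the concentration functions of projections\<close>

definition re_psi :: "real^'d \<Rightarrow> real" where
  "re_psi x = (x \<bullet> (A *v x)) / 2 + (\<integral>z. 1 - cos (x \<bullet> z) \<partial>N)"

text \<open>\<open>dir_h\<close> and \<open>dir_K\<close> are the one-dimensional concentration functions of the projection on \<open>x\<close>,
  with the radius absorbed into \<open>x\<close>: radius \<open>r\<close> in direction \<open>e\<close> corresponds to \<open>x = e / r\<close>.\<close>

definition dir_h :: "real^'d \<Rightarrow> real" where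
  "dir_h x = x \<bullet> (A *v x) + (\<integral>z. min 1 ((x \<bullet> z)\<^sup>2) \<partial>N)"

definition dir_K :: "real^'d \<Rightarrow> real" where
  "dir_K x = x \<bullet> (A *v x) + (\<integral>z. indicator {z. \<bar>x \<bullet> z\<bar> < 1} z * (x \<bullet> z)\<^sup>2 \<partial>N)"

abbreviation h :: "real \<Rightarrow> real" where "h \<equiv> hfun A N"

abbreviation \<Psi> :: "real^'d \<Rightarrow> complex" where "\<Psi> \<equiv> levy_exponent A N b"

text \<open>For |z| < 1 the compensator leaves a second-order Taylor remainder, and for |z| \<ge> 1
  the integrand has modulus at most 2. So the complex integral converges and the real part passes
  inside, where the compensator, being imaginary, disappears.\<close>

lemma Re_exponent: "Re (\<Psi> x) = re_psi x"
proof -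
  let ?g = "\<lambda>z. 1 - exp (\<i> * complex_of_real (x \<bullet> z)) + \<i> * complex_of_real (x \<bullet> z) * indicator {z. norm z < 1} z"
  have "integrable N ?g"
  proof (rule integrable_levy_bound[where K="2 + (norm x)\<^sup>2"])
    fix z :: "real^'d"
    show "cmod (?g z) \<le> (2 + (norm x)\<^sup>2) * min 1 ((norm z)\<^sup>2)"
    proof (cases "norm z < 1")
      case True
      have "cmod (?g z) = cmod (iexp (x \<bullet> z) - (\<Sum>k\<le>1. (\<i> * complex_of_real (x \<bullet> z)) ^ k / fact k))"
        using True by (subst norm_minus_cancel[symmetric]) (simp add: algebra_simps)
      also have "\<dots> \<le> \<bar>x \<bullet> z\<bar>\<^sup>2 / 2" using iexp_approx1[of "x \<bullet> z" 1] by (simp add: numeral_2_eq_2)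
      also have "\<dots> \<le> (norm x * norm z)\<^sup>2 / 2"
        by (intro divide_right_mono power_mono Cauchy_Schwarz_ineq2) auto
      also have "\<dots> \<le> (2 + (norm x)\<^sup>2) * (norm z)\<^sup>2" by (simp add: power_mult_distrib algebra_simps)
      also have "(norm z)\<^sup>2 = min 1 ((norm z)\<^sup>2)" using True by (simp add: power_le_one)
      finally show ?thesis .
    next
      case False
      then have "cmod (?g z) \<le> 2"
        using norm_triangle_ineq4[of 1 "exp (\<i> * complex_of_real (x \<bullet> z))"] by simp
      moreover have "1 \<le> (norm z)\<^sup>2" using False by simp
      ultimately show ?thesis by (simp add: min_def add_increasing2)
    qed
  qed measurable
  then have "Re (integral\<^sup>L N ?g) = (\<integral>z. Re (?g z) \<partial>N)"
    by (rule integral_Re[symmetric])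
  also have "\<dots> = (\<integral>z. 1 - cos (x \<bullet> z) \<partial>N)"
    by (intro Bochner_Integration.integral_cong) (auto simp: Re_exp indicator_def)
  finally show ?thesis by (simp add: levy_exponent_def re_psi_def)
qed

lemma re_psi_nonneg: "0 \<le> re_psi x"
  unfolding re_psi_def using A_nonneg[of x] by (intro add_nonneg_nonneg integral_nonneg_AE) auto

lemma re_psi_0: "re_psi 0 = 0"
  by (simp add: re_psi_def)

lemma quad_form_add_le:
  "(x + y) \<bullet> (A *v (x + y)) \<le> 2 * (x \<bullet> (A *v x)) + 2 * (y \<bullet> (A *v y))"
  using A_nonneg[of "x - y"] by (simp add: matrix_vector_mult_diff_distrib matrix_vector_right_distrib inner_simps)

lemma quad_form_scaleR: "(c *\<^sub>R x) \<bullet> (A *v (c *\<^sub>R x)) = c\<^sup>2 * (x \<bullet> (A *v x))"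
  by (simp add: matrix_vector_mult_scaleR power2_eq_square)

text \<open>Both parts behave like squares, so (a + b)^2 \<le> 2 a^2 + 2 b^2 carries over: to the
  quadratic form because A is non-negative, to 1 - cos by the half-angle formula.\<close>

lemma re_psi_add_le: "re_psi (x + y) \<le> 2 * re_psi x + 2 * re_psi y"
proof -
  have "(\<integral>z. 1 - cos ((x + y) \<bullet> z) \<partial>N) \<le> (\<integral>z. 2 * (1 - cos (x \<bullet> z)) + 2 * (1 - cos (y \<bullet> z)) \<partial>N)"
  proof (rule integral_mono)
    show "1 - cos ((x + y) \<bullet> z) \<le> 2 * (1 - cos (x \<bullet> z)) + 2 * (1 - cos (y \<bullet> z))" for z
      unfolding inner_add_left by (rule one_minus_cos_add)
  qed (intro integrable_one_minus_cos Bochner_Integration.integrable_add integrable_mult_right)+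
  also have "\<dots> = 2 * (\<integral>z. 1 - cos (x \<bullet> z) \<partial>N) + 2 * (\<integral>z. 1 - cos (y \<bullet> z) \<partial>N)"
    by (subst Bochner_Integration.integral_add)
       (intro integrable_one_minus_cos integrable_mult_right integral_mult_right_zero | simp only: integral_mult_right_zero)+
  finally show ?thesis using quad_form_add_le[of x y] by (simp add: re_psi_def)
qed

lemma re_psi_mult_le: "re_psi (real k *\<^sub>R x) \<le> (real k)\<^sup>2 * re_psi x"
proof -
  have "(\<integral>z. 1 - cos ((real k *\<^sub>R x) \<bullet> z) \<partial>N) \<le> (\<integral>z. (real k)\<^sup>2 * (1 - cos (x \<bullet> z)) \<partial>N)"
  proof (rule integral_mono)
    show "1 - cos ((real k *\<^sub>R x) \<bullet> z) \<le> (real k)\<^sup>2 * (1 - cos (x \<bullet> z))" for z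
      unfolding inner_scaleR_left by (rule one_minus_cos_mult)
  qed (intro integrable_one_minus_cos integrable_mult_right)+
  then show ?thesis
    unfolding re_psi_def quad_form_scaleR integral_mult_right_zero by (simp add: distrib_left)
qed

lemma re_psi_le_dir_h: "re_psi x \<le> 2 * dir_h x"
proof -
  have "(\<integral>z. 1 - cos (x \<bullet> z) \<partial>N) \<le> (\<integral>z. 2 * min 1 ((x \<bullet> z)\<^sup>2) \<partial>N)"
    by (intro integral_mono cos_quadratic_bound integrable_one_minus_cos integrable_mult_right integrable_min_inner)
  then show ?thesis using A_nonneg[of x] by (simp add: re_psi_def dir_h_def)
qed

lemma dir_K_le_re_psi: "dir_K x \<le> 4 * re_psi x"
proof -
  have "(\<integral>z. indicator {z. \<bar>x \<bullet> z\<bar> < 1} z * (x \<bullet> z)\<^sup>2 \<partial>N) \<le> (\<integral>z. 4 * (1 - cos (x \<bullet> z)) \<partial>N)"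
    by (intro integral_mono integrable_trunc_sq integrable_mult_right integrable_one_minus_cos)
       (use cos_quadratic_lower[of "x \<bullet> _"] in \<open>auto simp: indicator_def\<close>)
  then have "(\<integral>z. indicator {z. \<bar>x \<bullet> z\<bar> < 1} z * (x \<bullet> z)\<^sup>2 \<partial>N) \<le> 4 * (\<integral>z. 1 - cos (x \<bullet> z) \<partial>N)"
    by (simp only: integral_mult_right_zero)
  then show ?thesis using A_nonneg[of x] unfolding dir_K_def re_psi_def by simp
qed

lemma dir_K_le_dir_h: "dir_K x \<le> dir_h x"
proof -
  have "(\<integral>z. indicator {z. \<bar>x \<bullet> z\<bar> < 1} z * (x \<bullet> z)\<^sup>2 \<partial>N) \<le> (\<integral>z. min 1 ((x \<bullet> z)\<^sup>2) \<partial>N)"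
    by (intro integral_mono integrable_trunc_sq integrable_min_inner)
       (auto simp: indicator_def abs_square_le_1)
  then show ?thesis by (simp add: dir_K_def dir_h_def)
qed

lemma dir_K_nonneg: "0 \<le> dir_K x"
  unfolding dir_K_def by (intro add_nonneg_nonneg A_nonneg integral_nonneg_AE) auto

text \<open>With y = x / l the two truncations differ only where |y . z| < 1, and there the first is
  at most l^2 (y . z)^2. Hence, if enlarging the radius by l costs a fixed share of
  \<open>dir_h\<close>, then \<open>dir_K\<close> at the larger radius is at least comparable to
  that loss.\<close>

lemma dir_h_diff_le:
  assumes "1 \<le> l"
  shows "dir_h x - dir_h (x /\<^sub>R l) \<le> l\<^sup>2 * dir_K (x /\<^sub>R l)"
proof -
  let ?y = "x /\<^sub>R l"
  have l: "0 < l" using assms by simp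
  have pw: "min 1 ((x \<bullet> z)\<^sup>2) - min 1 ((?y \<bullet> z)\<^sup>2) \<le> l\<^sup>2 * (indicator {z. \<bar>?y \<bullet> z\<bar> < 1} z * (?y \<bullet> z)\<^sup>2)" for z
  proof (cases "\<bar>?y \<bullet> z\<bar> < 1")
    case True
    have "(x \<bullet> z)\<^sup>2 = l\<^sup>2 * (?y \<bullet> z)\<^sup>2" using l by (simp add: power_mult_distrib power_inverse)
    then have "min 1 ((x \<bullet> z)\<^sup>2) \<le> l\<^sup>2 * (?y \<bullet> z)\<^sup>2" by simp
    moreover have "0 \<le> min 1 ((?y \<bullet> z)\<^sup>2)" by simp
    ultimately show ?thesis using True by (simp only: indicator_def mem_Collect_eq if_True of_bool_eq)
  next
    case False
    then have "1 \<le> (?y \<bullet> z)\<^sup>2" using abs_le_square_iff[of 1 "?y \<bullet> z"] by simp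
    then show ?thesis using False by (simp add: min_def)
  qed
  have "(\<integral>z. min 1 ((x \<bullet> z)\<^sup>2) \<partial>N) - (\<integral>z. min 1 ((?y \<bullet> z)\<^sup>2) \<partial>N) = (\<integral>z. min 1 ((x \<bullet> z)\<^sup>2) - min 1 ((?y \<bullet> z)\<^sup>2) \<partial>N)"
    by (rule Bochner_Integration.integral_diff[symmetric]) (rule integrable_min_inner)+
  also have "\<dots> \<le> (\<integral>z. l\<^sup>2 * (indicator {z. \<bar>?y \<bullet> z\<bar> < 1} z * (?y \<bullet> z)\<^sup>2) \<partial>N)"
    by (intro integral_mono pw Bochner_Integration.integrable_diff integrable_min_inner integrable_mult_right integrable_trunc_sq)
  also have "\<dots> = l\<^sup>2 * (\<integral>z. indicator {z. \<bar>?y \<bullet> z\<bar> < 1} z * (?y \<bullet> z)\<^sup>2 \<partial>N)"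
    by (rule integral_mult_right_zero)
  finally have 1: "(\<integral>z. min 1 ((x \<bullet> z)\<^sup>2) \<partial>N) - (\<integral>z. min 1 ((?y \<bullet> z)\<^sup>2) \<partial>N) \<le> l\<^sup>2 * (\<integral>z. indicator {z. \<bar>?y \<bullet> z\<bar> < 1} z * (?y \<bullet> z)\<^sup>2 \<partial>N)" .
  have "x \<bullet> (A *v x) = l\<^sup>2 * (?y \<bullet> (A *v ?y))"
    using l by (simp only: quad_form_scaleR) (simp add: power_inverse)
  then show ?thesis
    using 1 A_nonneg[of ?y] unfolding dir_h_def dir_K_def distrib_left by linarith
qed

text \<open>Doubling the radius divides the integrand by 4 wherever |x . z| < 1, which removes three
  quarters of \<open>dir_K\<close>. This is a dyadic substitute for differentiating
  \<open>dir_h\<close> in the radius.\<close>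

lemma dir_h_half_le: "dir_h (x /\<^sub>R 2) \<le> dir_h x - 3 / 4 * dir_K x"
proof -
  let ?y = "x /\<^sub>R 2"
  have pw: "min 1 ((?y \<bullet> z)\<^sup>2) \<le> min 1 ((x \<bullet> z)\<^sup>2) - 3 / 4 * (indicator {z. \<bar>x \<bullet> z\<bar> < 1} z * (x \<bullet> z)\<^sup>2)" for z
  proof -
    have y: "(?y \<bullet> z)\<^sup>2 = (x \<bullet> z)\<^sup>2 / 4" by (simp add: power2_eq_square)
    show ?thesis
    proof (cases "\<bar>x \<bullet> z\<bar> < 1")
      case True
      then have "(x \<bullet> z)\<^sup>2 \<le> 1" by (simp add: abs_square_le_1)
      then show ?thesis using True unfolding y by (simp add: min_def)
    next
      case False
      then have "1 \<le> (x \<bullet> z)\<^sup>2" using abs_le_square_iff[of 1 "x \<bullet> z"] by simp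
      then show ?thesis using False by (simp add: min_def)
    qed
  qed
  have "(\<integral>z. min 1 ((?y \<bullet> z)\<^sup>2) \<partial>N) \<le> (\<integral>z. min 1 ((x \<bullet> z)\<^sup>2) - 3 / 4 * (indicator {z. \<bar>x \<bullet> z\<bar> < 1} z * (x \<bullet> z)\<^sup>2) \<partial>N)"
    by (intro integral_mono pw Bochner_Integration.integrable_diff integrable_min_inner integrable_mult_right integrable_trunc_sq)
  also have "\<dots> = (\<integral>z. min 1 ((x \<bullet> z)\<^sup>2) \<partial>N) - 3 / 4 * (\<integral>z. indicator {z. \<bar>x \<bullet> z\<bar> < 1} z * (x \<bullet> z)\<^sup>2 \<partial>N)"
    by (subst Bochner_Integration.integral_diff)
       (intro integrable_min_inner integrable_mult_right integrable_trunc_sq | simp only: integral_mult_right_zero)+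
  finally show ?thesis
    using A_nonneg[of x] unfolding dir_h_def dir_K_def quad_form_scaleR distrib_left by (simp add: power_divide)
qed

lemma dir_h_le_h:
  assumes "x \<noteq> 0"
  shows "dir_h x \<le> h (1 / norm x)"
proof -
  have "(x \<bullet> z)\<^sup>2 \<le> (norm x)\<^sup>2 * (norm z)\<^sup>2" for z
    using power_mono[OF Cauchy_Schwarz_ineq2[of x z], of 2] by (simp add: power_mult_distrib)
  then have "(\<integral>z. min 1 ((x \<bullet> z)\<^sup>2) \<partial>N) \<le> (\<integral>z. min 1 ((norm z)\<^sup>2 / (1 / norm x)\<^sup>2) \<partial>N)"
    using assms by (intro integral_mono integrable_min_inner integrable_h)
      (auto simp: power_divide mult.commute[of "(norm x)\<^sup>2"] min.coboundedI2)
  moreover have "x \<bullet> (A *v x) \<le> norm x * (onorm ((*v) A) * norm x)"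
    by (intro order_trans[OF norm_cauchy_schwarz] mult_left_mono onorm matrix_vector_mul_bounded_linear) auto
  ultimately show ?thesis
    using assms by (simp add: dir_h_def hfun_def power2_eq_square mult_ac)
qed


text \<open>Infinite mass can accumulate only at the origin, so the null set {0} and the sets |z|
  \<ge> 1 / (n + 1) exhaust the space. Fubini over \<open>N\<close>, and with it the measurability
  of \<open>re_psi\<close>, rests on this.\<close>

lemma sigma_finite_N: "sigma_finite_measure N"
proof
  define S where "S n = {z::real^'d. 1 / real (Suc n) \<le> norm z}" for n :: nat
  have S[measurable]: "S n \<in> sets borel" for n unfolding S_def by measurable
  have "emeasure N (S n) < \<infinity>" for n
  proof -
    have "integrable N (indicator (S n) :: _ \<Rightarrow> real)"
    proof (rule integrable_levy_bound[where K="(real (Suc n))\<^sup>2"])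
      fix z :: "real^'d"
      show "norm (indicator (S n) z :: real) \<le> (real (Suc n))\<^sup>2 * min 1 ((norm z)\<^sup>2)"
      proof (cases "z \<in> S n")
        case True
        then have "1 \<le> real (Suc n) * norm z" by (simp add: S_def field_simps)
        then have "1 \<le> (real (Suc n))\<^sup>2 * (norm z)\<^sup>2"
          using power_mono[of 1 "real (Suc n) * norm z" 2] by (simp add: power_mult_distrib)
        moreover have "1 \<le> (real (Suc n))\<^sup>2 * 1" by (simp del: of_nat_Suc)
        ultimately show ?thesis using True by (simp add: min_def del: of_nat_Suc)
      qed simp
    qed measurable
    then show ?thesis by (simp add: integrable_indicator_iff)
  qed
  moreover have "emeasure N {0} < \<infinity>" using N by (simp add: levy_measure_def)
  moreover have "z \<in> \<Union> (insert {0} (range S))" for z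
  proof (cases "z = 0")
    case False
    then obtain n where "inverse (real (Suc n)) < norm z"
      using reals_Archimedean[of "norm z"] by auto
    then have "z \<in> S n" by (simp add: S_def inverse_eq_divide)
    then show ?thesis by auto
  qed auto
  ultimately show "\<exists>S. countable S \<and> S \<subseteq> sets N \<and> \<Union> S = space N \<and> (\<forall>a\<in>S. emeasure N a \<noteq> \<infinity>)"
    by (intro exI[of _ "insert {0} (range S)"]) (auto simp: less_top)
qed

lemma borel_measurable_re_psi [measurable]: "re_psi \<in> borel_measurable borel"
proof -
  interpret sigma_finite_measure N by (rule sigma_finite_N)
  have [measurable]: "(\<lambda>x. A *v x) \<in> borel_measurable borel"
    by (intro borel_measurable_continuous_onI linear_continuous_on matrix_vector_mul_bounded_linear)
  show ?thesis unfolding re_psi_def[abs_def] by measurable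
qed

lemma h_antimono:
  assumes "0 < r" "r \<le> s"
  shows "h s \<le> h r"
proof -
  have sq: "r\<^sup>2 \<le> s\<^sup>2" using assms by (intro power_mono) auto
  have "(\<integral>z. min 1 ((norm z)\<^sup>2 / s\<^sup>2) \<partial>N) \<le> (\<integral>z. min 1 ((norm z)\<^sup>2 / r\<^sup>2) \<partial>N)"
    using assms sq by (intro integral_mono integrable_h min.mono divide_left_mono) auto
  moreover have "onorm ((*v) A) / s\<^sup>2 \<le> onorm ((*v) A) / r\<^sup>2"
    using assms sq by (intro divide_left_mono onorm_pos_le matrix_vector_mul_bounded_linear) auto
  ultimately show ?thesis by (simp add: hfun_def)
qed

text \<open>Multiplied by r^2 the integrand becomes min (r^2) (|z|^2), which increases in r. Thus h
  falls at most quadratically, the counterpart of its monotonicity.\<close>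

lemma h_quadratic_growth:
  assumes "0 < r" "r \<le> s"
  shows "r\<^sup>2 * h r \<le> s\<^sup>2 * h s"
proof -
  have s: "0 < s" and sq: "r\<^sup>2 \<le> s\<^sup>2" using assms by (auto intro: power_mono)
  have eq: "u\<^sup>2 * min 1 ((norm z)\<^sup>2 / u\<^sup>2) = min (u\<^sup>2) ((norm z)\<^sup>2)" if "0 < u" for u z
    using that by (simp add: min_mult_distrib_left)
  have "(\<integral>z. r\<^sup>2 * min 1 ((norm z)\<^sup>2 / r\<^sup>2) \<partial>N) \<le> (\<integral>z. s\<^sup>2 * min 1 ((norm z)\<^sup>2 / s\<^sup>2) \<partial>N)"
  proof (rule integral_mono)
    show "r\<^sup>2 * min 1 ((norm z)\<^sup>2 / r\<^sup>2) \<le> s\<^sup>2 * min 1 ((norm z)\<^sup>2 / s\<^sup>2)" for z :: "real^'d"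
      using assms s sq by (simp only: eq)
  qed (intro integrable_mult_right integrable_h assms s)+
  then show ?thesis using assms s by (simp add: hfun_def distrib_left)
qed

lemma re_psi_le_h:
  assumes "0 < r" "norm x \<le> 1 / r"
  shows "re_psi x \<le> 2 * h r"
proof (cases "x = 0")
  case True
  have "0 \<le> h r" unfolding hfun_def using assms
    by (intro add_nonneg_nonneg divide_nonneg_nonneg onorm_pos_le integral_nonneg_AE matrix_vector_mul_bounded_linear) auto
  then show ?thesis using True by (simp add: re_psi_0)
next
  case False
  have "re_psi x \<le> 2 * h (1 / norm x)"
    using re_psi_le_dir_h[of x] dir_h_le_h[OF False] by linarith
  also have "h (1 / norm x) \<le> h r"
    using assms False by (intro h_antimono) (auto simp: field_simps)
  finally show ?thesis by simp
qed

section \<open>Comparability of Psi* (r) and h (1 / r)\<close>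

lemma psi_star_alt: "psi_star \<Psi> r = Sup (re_psi ` {z. norm z \<le> r})"
  unfolding psi_star_def Re_exponent by (simp add: setcompr_eq_image)

lemma bdd_above_re_psi: "0 < r \<Longrightarrow> bdd_above (re_psi ` {z. norm z \<le> r})"
  using re_psi_le_h[of "1 / r"] by (auto intro!: bdd_aboveI[of _ "2 * h (1 / r)"])

lemma re_psi_le_psi_star: "0 < r \<Longrightarrow> norm x \<le> r \<Longrightarrow> re_psi x \<le> psi_star \<Psi> r"
  unfolding psi_star_alt by (intro cSUP_upper bdd_above_re_psi) auto

lemma psi_star_le_h: "0 < r \<Longrightarrow> psi_star \<Psi> r \<le> 2 * h (1 / r)"
  unfolding psi_star_alt using re_psi_le_h[of "1 / r"] by (intro cSUP_least) (auto intro: exI[of _ 0])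

lemma psi_star_nonneg: "0 < r \<Longrightarrow> 0 \<le> psi_star \<Psi> r"
  using re_psi_le_psi_star[of r 0] by (simp add: re_psi_0)

lemma psi_star_0: "psi_star \<Psi> 0 = 0"
  by (simp add: psi_star_alt re_psi_0)

lemma psi_star_mono:
  assumes "0 < r" "r \<le> s"
  shows "psi_star \<Psi> r \<le> psi_star \<Psi> s"
  unfolding psi_star_alt using assms
  by (intro cSUP_subset_mono bdd_above_re_psi) (auto intro: exI[of _ 0])

text \<open>Polarisation recovers the operator norm of \<open>A\<close> from its quadratic form, without the spectral theorem.\<close>

lemma onorm_le_psi_star:
  assumes r: "0 < r"
  shows "onorm ((*v) A) * r\<^sup>2 \<le> 2 * psi_star \<Psi> r"
proof -
  define S where "S = 2 * psi_star \<Psi> r / r\<^sup>2"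
  have S0: "0 \<le> S" using psi_star_nonneg[OF r] by (simp add: S_def)
  have quad: "y \<bullet> (A *v y) \<le> S * (norm y)\<^sup>2" for y
  proof (cases "y = 0")
    case False
    define x where "x = (r / norm y) *\<^sub>R y"
    have "norm x \<le> r" using r False by (simp add: x_def)
    have "0 \<le> (\<integral>z. 1 - cos (x \<bullet> z) \<partial>N)" by (intro integral_nonneg_AE) auto
    then have "x \<bullet> (A *v x) \<le> 2 * psi_star \<Psi> r"
      using re_psi_le_psi_star[OF r \<open>norm x \<le> r\<close>] unfolding re_psi_def by linarith
    also have "x \<bullet> (A *v x) = (r / norm y)\<^sup>2 * (y \<bullet> (A *v y))" unfolding x_def by (rule quad_form_scaleR)
    finally show ?thesis using r False by (simp add: S_def field_simps)
  qed simp
  have "norm (A *v y) \<le> S * norm y" for y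
  proof (cases "y = 0 \<or> A *v y = 0")
    case False
    \<comment> \<open>Length of y, direction of A y: with this x the bilinear form x . A y equals
      |y| |A y|.\<close>
    define x where "x = (norm y / norm (A *v y)) *\<^sub>R (A *v y)"
    have nx: "norm x = norm y" using False by (simp add: x_def)
    have "4 * (x \<bullet> (A *v y)) = (x + y) \<bullet> (A *v (x + y)) - (x - y) \<bullet> (A *v (x - y))"
      using A_sym[of x y] by (simp add: matrix_vector_mult_diff_distrib matrix_vector_right_distrib inner_simps)
    also have "\<dots> \<le> S * (norm (x + y))\<^sup>2" using quad[of "x + y"] A_nonneg[of "x - y"] by linarith
    also have "\<dots> \<le> S * (2 * norm y)\<^sup>2"
      using norm_triangle_ineq[of x y] nx by (intro mult_left_mono S0 power_mono) auto
    finally have "x \<bullet> (A *v y) \<le> S * (norm y)\<^sup>2" by simp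
    moreover have "x \<bullet> (A *v y) = norm y * norm (A *v y)"
      using False by (simp add: x_def power2_norm_eq_inner[symmetric] power2_eq_square)
    ultimately show ?thesis using False by (simp add: power2_eq_square)
  qed (use S0 in auto)
  then have "onorm ((*v) A) \<le> S" by (rule onorm_le)
  then show ?thesis using r by (simp add: S_def field_simps)
qed

text \<open>All points u x with 0 \<le> u \<le> 1 lie in the ball over which \<open>psi_star\<close>
  is a supremum, so the average over u of the jump part of \<open>re_psi\<close> stays below it. By
  Tonelli that average dominates one eighth of the left side.\<close>

lemma integral_min_inner_le_psi_star:
  assumes r: "0 < r" and x: "norm x \<le> r"
  shows "(\<integral>z. min 1 ((x \<bullet> z)\<^sup>2) \<partial>N) \<le> 8 * psi_star \<Psi> r"
proof -
  interpret sigma_finite_measure N by (rule sigma_finite_N)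
  interpret P: pair_sigma_finite N lborel ..
  have "ennreal (\<integral>z. min 1 ((x \<bullet> z)\<^sup>2) \<partial>N) = (\<integral>\<^sup>+z. ennreal (min 1 ((x \<bullet> z)\<^sup>2)) \<partial>N)"
    by (intro nn_integral_eq_integral[symmetric] integrable_min_inner) auto
  also have "\<dots> \<le> (\<integral>\<^sup>+z. ennreal 8 * (\<integral>\<^sup>+u. ennreal (1 - cos (u * (x \<bullet> z))) * indicator {0..1} u \<partial>lborel) \<partial>N)"
    by (intro nn_integral_mono nn_integral_one_minus_cos)
  also have "\<dots> = ennreal 8 * (\<integral>\<^sup>+z. (\<integral>\<^sup>+u. ennreal (1 - cos (u * (x \<bullet> z))) * indicator {0..1} u \<partial>lborel) \<partial>N)"
    by (rule nn_integral_cmult) measurable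
  also have "(\<integral>\<^sup>+z. (\<integral>\<^sup>+u. ennreal (1 - cos (u * (x \<bullet> z))) * indicator {0..1} u \<partial>lborel) \<partial>N) =
      (\<integral>\<^sup>+u. (\<integral>\<^sup>+z. ennreal (1 - cos (u * (x \<bullet> z))) * indicator {0..1} u \<partial>N) \<partial>lborel)"
    by (rule P.Fubini'[symmetric]) measurable
  also have "\<dots> \<le> (\<integral>\<^sup>+u. ennreal (psi_star \<Psi> r) * indicator {0..1} (u::real) \<partial>lborel)"
  proof (rule nn_integral_mono)
    fix u :: real
    have "(\<integral>\<^sup>+z. ennreal (1 - cos (u * (x \<bullet> z))) \<partial>N) \<le> ennreal (psi_star \<Psi> r)" if u: "u \<in> {0..1}"
    proof -
      have "norm (u *\<^sub>R x) \<le> r"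
        using x u r mult_mono[of u 1 "norm x" r] by simp
      have "(\<integral>\<^sup>+z. ennreal (1 - cos (u * (x \<bullet> z))) \<partial>N) = ennreal (\<integral>z. 1 - cos ((u *\<^sub>R x) \<bullet> z) \<partial>N)"
        unfolding inner_scaleR_left[symmetric]
        by (intro nn_integral_eq_integral integrable_one_minus_cos) auto
      also have "\<dots> \<le> ennreal (re_psi (u *\<^sub>R x))"
        using A_nonneg[of "u *\<^sub>R x"] unfolding re_psi_def by (intro ennreal_leI) linarith
      also have "\<dots> \<le> ennreal (psi_star \<Psi> r)"
        by (intro ennreal_leI re_psi_le_psi_star) fact+
      finally show ?thesis .
    qed
    then show "(\<integral>\<^sup>+z. ennreal (1 - cos (u * (x \<bullet> z))) * indicator {0..1} u \<partial>N) \<le> ennreal (psi_star \<Psi> r) * indicator {0..1} u"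
      by (cases "u \<in> {0..1}") (auto simp del: atLeastAtMost_iff)
  qed
  also have "\<dots> = ennreal (psi_star \<Psi> r)"
    by (subst nn_integral_cmult_indicator) auto
  finally have "ennreal (\<integral>z. min 1 ((x \<bullet> z)\<^sup>2) \<partial>N) \<le> ennreal 8 * ennreal (psi_star \<Psi> r)"
    by (simp add: mult_left_mono)
  also have "\<dots> = ennreal (8 * psi_star \<Psi> r)" by (rule ennreal_mult'[symmetric]) simp
  finally show ?thesis using psi_star_nonneg[OF r] by (subst (asm) ennreal_le_iff) auto
qed

text \<open>The 2 pays for the operator norm of A, and each coordinate direction contributes
  8.\<close>

definition cmp_const :: real where "cmp_const = 2 + 8 * real CARD('d)"

lemma cmp_const_pos: "0 < cmp_const"
  by (simp add: cmp_const_def add_pos_nonneg)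

text \<open>Truncation at 1 is subadditive and |z|^2 is a sum of squared coordinates, so the jump
  part of h is at most a sum of integrals for the projections on the axes. With
  \<open>psi_star_le_h\<close> this makes the two functions comparable.\<close>

lemma h_le_psi_star:
  assumes r: "0 < r"
  shows "h (1 / r) \<le> cmp_const * psi_star \<Psi> r"
proof -
  have "(\<integral>z. min 1 ((norm z)\<^sup>2 / (1 / r)\<^sup>2) \<partial>N) \<le> (\<integral>z. (\<Sum>e\<in>Basis. min 1 (((r *\<^sub>R e) \<bullet> z)\<^sup>2)) \<partial>N)"
  proof (intro integral_mono integrable_h Bochner_Integration.integrable_sum integrable_min_inner)
    fix z :: "real^'d"
    have "(norm z)\<^sup>2 = (\<Sum>e\<in>Basis. (z \<bullet> e)\<^sup>2)"
      unfolding power2_norm_eq_inner by (subst euclidean_inner) (simp add: power2_eq_square)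
    then have "(norm z)\<^sup>2 / (1 / r)\<^sup>2 = (\<Sum>e\<in>Basis. ((r *\<^sub>R e) \<bullet> z)\<^sup>2)"
      by (simp add: power_divide power_mult_distrib sum_distrib_left inner_commute mult.commute)
    then show "min 1 ((norm z)\<^sup>2 / (1 / r)\<^sup>2) \<le> (\<Sum>e\<in>Basis. min 1 (((r *\<^sub>R e) \<bullet> z)\<^sup>2))"
      by (simp only:) (rule min_one_sum_le, auto)
  qed (use r in auto)
  also have "\<dots> = (\<Sum>e\<in>Basis. (\<integral>z. min 1 (((r *\<^sub>R e) \<bullet> z)\<^sup>2) \<partial>N))"
    by (rule Bochner_Integration.integral_sum) (rule integrable_min_inner)
  also have "\<dots> \<le> (\<Sum>e\<in>(Basis :: (real^'d) set). 8 * psi_star \<Psi> r)"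
    using r by (intro sum_mono integral_min_inner_le_psi_star) auto
  also have "\<dots> = real CARD('d) * (8 * psi_star \<Psi> r)" by simp
  finally have "h (1 / r) \<le> onorm ((*v) A) * r\<^sup>2 + real CARD('d) * (8 * psi_star \<Psi> r)"
    by (simp add: hfun_def power_divide)
  then show ?thesis
    using onorm_le_psi_star[OF r] by (simp add: cmp_const_def algebra_simps)
qed

text \<open>If \<open>re_psi\<close> is small at \<open>x\<close>, it stays small on the disjoint balls around \<open>x, 2 x, \<dots>, n x\<close>, because
  \<open>re_psi (k x) \<le> k\<^sup>2 re_psi x\<close>. This replaces the Riemann--Lebesgue lemma and yields nondegeneracy.\<close>

lemma nn_integral_exp_re_psi_lower:
  assumes t: "0 < t" and \<rho>: "0 < \<rho>" "2 * \<rho> \<le> norm x"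
    and x: "(real n)\<^sup>2 * (t * re_psi x) \<le> a"
    and y: "\<And>y. norm y < \<rho> \<Longrightarrow> t * re_psi y \<le> c"
  shows "ennreal (real n * (unit_ball_vol (real CARD('d)) * \<rho> ^ CARD('d)) * exp (- (2 * a + 2 * c)))
    \<le> (\<integral>\<^sup>+z. ennreal (exp (- t * re_psi z)) \<partial>lborel)"
proof -
  let ?B = "\<lambda>k. ball (real k *\<^sub>R x) \<rho>" and ?E = "exp (- (2 * a + 2 * c))"
  have disj: "disjoint_family_on ?B {1..n}"
    unfolding disjoint_family_on_def
  proof (intro ballI impI)
    fix k l :: nat assume "k \<noteq> l"
    show "?B k \<inter> ?B l = {}"
    proof (rule ccontr)
      assume "?B k \<inter> ?B l \<noteq> {}"
      then obtain z where "dist (real k *\<^sub>R x) z < \<rho>" "dist (real l *\<^sub>R x) z < \<rho>" by auto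
      then have "dist (real k *\<^sub>R x) (real l *\<^sub>R x) < 2 * \<rho>"
        using dist_triangle2[of "real k *\<^sub>R x" "real l *\<^sub>R x" z] by linarith
      moreover have "dist (real k *\<^sub>R x) (real l *\<^sub>R x) = \<bar>real k - real l\<bar> * norm x"
        by (simp add: dist_norm scaleR_left_diff_distrib[symmetric])
      moreover have "1 * norm x \<le> \<bar>real k - real l\<bar> * norm x"
        using \<open>k \<noteq> l\<close> by (intro mult_right_mono) auto
      ultimately show False using \<rho> by linarith
    qed
  qed
  have bound: "t * re_psi z \<le> 2 * a + 2 * c" if "z \<in> (\<Union>k\<in>{1..n}. ?B k)" for z
  proof -
    from that obtain k where "k \<in> {1..n}" "z \<in> ?B k" by blast
    then have k: "k \<le> n" "dist (real k *\<^sub>R x) z < \<rho>" by auto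
    define w where "w = z - real k *\<^sub>R x"
    have "norm w < \<rho>" using k by (simp add: w_def dist_norm norm_minus_commute)
    have "t * re_psi z \<le> t * (2 * re_psi (real k *\<^sub>R x) + 2 * re_psi w)"
      using re_psi_add_le[of "real k *\<^sub>R x" w] t by (simp add: w_def)
    also have "\<dots> = 2 * (t * re_psi (real k *\<^sub>R x)) + 2 * (t * re_psi w)"
      by (simp add: algebra_simps)
    also have "\<dots> \<le> 2 * a + 2 * c"
    proof -
      have "t * re_psi (real k *\<^sub>R x) \<le> t * ((real k)\<^sup>2 * re_psi x)"
        using t by (intro mult_left_mono re_psi_mult_le) auto
      also have "\<dots> \<le> t * ((real n)\<^sup>2 * re_psi x)"
        using t k re_psi_nonneg[of x] by (intro mult_left_mono mult_right_mono power_mono) auto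
      finally show ?thesis using x y[OF \<open>norm w < \<rho>\<close>] by (simp add: algebra_simps)
    qed
    finally show ?thesis .
  qed
  have "ennreal (real n * (unit_ball_vol (real CARD('d)) * \<rho> ^ CARD('d)) * ?E) =
      ennreal ?E * (\<Sum>k\<in>{1..n}. emeasure lborel (?B k))"
    using \<rho> by (simp add: emeasure_ball ennreal_of_nat_eq_real_of_nat mult_ac flip: ennreal_mult')
  also have "(\<Sum>k\<in>{1..n}. emeasure lborel (?B k)) = emeasure lborel (\<Union>k\<in>{1..n}. ?B k)"
    by (rule sum_emeasure[OF _ disj]) auto
  also have "ennreal ?E * \<dots> = (\<integral>\<^sup>+z. ennreal ?E * indicator (\<Union>k\<in>{1..n}. ?B k) z \<partial>lborel)"
    by (rule nn_integral_cmult_indicator[symmetric]) auto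
  also have "\<dots> \<le> (\<integral>\<^sup>+z. ennreal (exp (- t * re_psi z)) \<partial>lborel)"
  proof (rule nn_integral_mono)
    fix z :: "real^'d"
    show "ennreal ?E * indicator (\<Union>k\<in>{1..n}. ?B k) z \<le> ennreal (exp (- t * re_psi z))"
      using bound[of z] by (cases "z \<in> (\<Union>k\<in>{1..n}. ?B k)") (simp_all add: ennreal_leI del: UN_iff)
  qed
  finally show ?thesis .
qed

end

section \<open>Strict monotonicity, continuity and inverse of h\<close>

locale unbounded_levy_triplet = levy_triplet A N b
  for A :: "real^'d^'d" and N :: "(real^'d) measure" and b :: "real^'d" +
  assumes h0: "filterlim (hfun A N) at_top (at_right 0)"
begin

lemma h_exceeds:
  assumes "0 < s"
  obtains u where "0 < u" "u < s" "c < h u"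
proof -
  have "eventually (\<lambda>u. c < h u) (at_right 0)" using h0 by (simp add: filterlim_at_top_dense)
  moreover have "eventually (\<lambda>u. u \<in> {0<..<s}) (at_right 0)" using assms by (rule eventually_at_right_real)
  ultimately have "eventually (\<lambda>u. 0 < u \<and> u < s \<and> c < h u) (at_right 0)"
    by eventually_elim auto
  then show thesis using that eventually_happens'[of "at_right (0::real)"] by auto
qed

lemma h_pos:
  assumes "0 < r"
  shows "0 < h r"
proof -
  obtain u where u: "0 < u" "u < r" "0 < h u" by (rule h_exceeds[OF assms])
  then have "0 < u\<^sup>2 * h u" by simp
  also have "\<dots> \<le> r\<^sup>2 * h r" using u by (intro h_quadratic_growth) auto
  finally show ?thesis by (simp add: zero_less_mult_iff)
qed

text \<open>Equal values at r < s would force A = 0 and, since the truncated integrands then agree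
  almost everywhere, confine N to |z| \<ge> s. But then h would be constant on (0, s], contrary to
  its blow-up at 0.\<close>

lemma h_strict_antimono:
  assumes r: "0 < r" "r < s"
  shows "h s < h r"
proof (rule ccontr)
  assume "\<not> h s < h r"
  then have eq: "h r = h s" using h_antimono[of r s] r by simp
  let ?f = "\<lambda>r (z::real^'d). min 1 ((norm z)\<^sup>2 / r\<^sup>2)"
  have s: "0 < s" using r by simp
  have sq: "r\<^sup>2 < s\<^sup>2" using r by (intro power_strict_mono) auto
  have f_mono: "?f s z \<le> ?f r z" for z
    using sq r by (intro min.mono divide_left_mono) auto
  have A1: "onorm ((*v) A) / s\<^sup>2 \<le> onorm ((*v) A) / r\<^sup>2"
    using r sq by (intro divide_left_mono onorm_pos_le matrix_vector_mul_bounded_linear) auto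
  have I1: "integral\<^sup>L N (?f s) \<le> integral\<^sup>L N (?f r)"
    using r s by (intro integral_mono integrable_h f_mono)
  have "onorm ((*v) A) / s\<^sup>2 = onorm ((*v) A) / r\<^sup>2" and I2: "integral\<^sup>L N (?f r) = integral\<^sup>L N (?f s)"
    using eq A1 I1 unfolding hfun_def by linarith+
  then have A0: "onorm ((*v) A) = 0" using sq r by (auto simp: field_simps)
  have "(\<integral>z. ?f r z - ?f s z \<partial>N) = 0"
    using I2 r s by (subst Bochner_Integration.integral_diff) (auto intro: integrable_h)
  then have "AE z in N. ?f r z - ?f s z = 0"
    using f_mono r s by (subst (asm) integral_nonneg_eq_0_iff_AE) (auto intro!: Bochner_Integration.integrable_diff integrable_h)
  then have AE: "AE z in N. s \<le> norm z"
    using AE_N_nonzero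
  proof eventually_elim
    case (elim z)
    show ?case
    proof (rule ccontr)
      assume "\<not> s \<le> norm z"
      then have "(norm z)\<^sup>2 < s\<^sup>2" by (intro power_strict_mono) auto
      then have "(norm z)\<^sup>2 / s\<^sup>2 < 1" using s by simp
      moreover have "(norm z)\<^sup>2 / s\<^sup>2 < (norm z)\<^sup>2 / r\<^sup>2"
        using elim sq r by (intro divide_strict_left_mono) auto
      ultimately show False using elim by (simp add: min_def split: if_splits)
    qed
  qed
  obtain u where u: "0 < u" "u < s" "h s < h u" by (rule h_exceeds[OF s])
  have "integral\<^sup>L N (?f u) = integral\<^sup>L N (?f s)"
  proof (rule integral_cong_AE)
    show "AE z in N. ?f u z = ?f s z"
      using AE
    proof eventually_elim
      case (elim z)
      have "s\<^sup>2 \<le> (norm z)\<^sup>2" "u\<^sup>2 \<le> (norm z)\<^sup>2" using elim u s by (auto intro!: power_mono)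
      then show ?case using u s by simp
    qed
  qed measurable
  then have "h u = h s" by (simp add: hfun_def A0)
  then show False using u by simp
qed

lemma h_less_iff: "0 < r \<Longrightarrow> 0 < s \<Longrightarrow> h r < h s \<longleftrightarrow> s < r"
  using h_strict_antimono[of s r] h_antimono[of r s] by force

text \<open>Monotonicity and quadratic growth squeeze h s between h r times min 1 ((r / s)^2) and h
  r times max 1 ((r / s)^2).\<close>

lemma h_continuous: "0 < r \<Longrightarrow> isCont h r"
proof -
  assume r: "0 < r"
  have up: "h s \<le> max 1 ((r / s)\<^sup>2) * h r" if "0 < s" for s
  proof (cases "r \<le> s")
    case True
    have "h s \<le> 1 * h r" using h_antimono[OF r True] by simp
    also have "\<dots> \<le> max 1 ((r / s)\<^sup>2) * h r" using h_pos[OF r] by (intro mult_right_mono) auto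
    finally show ?thesis .
  next
    case False
    then have "h s \<le> (r / s)\<^sup>2 * h r"
      using h_quadratic_growth[of s r] that by (simp add: field_simps power_divide)
    also have "\<dots> \<le> max 1 ((r / s)\<^sup>2) * h r" using h_pos[OF r] by (intro mult_right_mono) auto
    finally show ?thesis .
  qed
  have lo: "min 1 ((r / s)\<^sup>2) * h r \<le> h s" if "0 < s" for s
  proof (cases "r \<le> s")
    case True
    have "min 1 ((r / s)\<^sup>2) * h r \<le> (r / s)\<^sup>2 * h r" using h_pos[OF r] by (intro mult_right_mono) auto
    also have "\<dots> \<le> h s"
      using h_quadratic_growth[OF r True] that by (simp add: field_simps power_divide)
    finally show ?thesis .
  next
    case False
    have "min 1 ((r / s)\<^sup>2) * h r \<le> 1 * h r" using h_pos[OF r] by (intro mult_right_mono) auto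
    also have "\<dots> \<le> h s" using h_antimono[of s r] that False by simp
    finally show ?thesis .
  qed
  have ev: "\<forall>\<^sub>F s in at r. 0 < s"
    using r eventually_at_in_open'[of "{0<..}" r] by simp
  have lim1: "((\<lambda>s. min 1 ((r / s)\<^sup>2) * h r) \<longlongrightarrow> min 1 ((r / r)\<^sup>2) * h r) (at r)"
    using r by (intro tendsto_intros) auto
  have lim2: "((\<lambda>s. max 1 ((r / s)\<^sup>2) * h r) \<longlongrightarrow> max 1 ((r / r)\<^sup>2) * h r) (at r)"
    using r by (intro tendsto_intros) auto
  have "(h \<longlongrightarrow> h r) (at r)"
  proof (rule tendsto_sandwich)
    show "\<forall>\<^sub>F s in at r. min 1 ((r / s)\<^sup>2) * h r \<le> h s" using ev by eventually_elim (rule lo)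
    show "\<forall>\<^sub>F s in at r. h s \<le> max 1 ((r / s)\<^sup>2) * h r" using ev by eventually_elim (rule up)
    show "((\<lambda>s. min 1 ((r / s)\<^sup>2) * h r) \<longlongrightarrow> h r) (at r)" using lim1 r by simp
    show "((\<lambda>s. max 1 ((r / s)\<^sup>2) * h r) \<longlongrightarrow> h r) (at r)" using lim2 r by simp
  qed
  then show ?thesis by (simp add: isCont_def)
qed

text \<open>Dominated convergence, with the integrand at radius 1 as majorant. Integer radii
  suffice: the intermediate value argument for \<open>hinv\<close> needs only one radius where h is
  below a given level.\<close>

lemma h_tendsto_0: "(\<lambda>n. h (real (Suc n))) \<longlonglongrightarrow> 0"
proof -
  have sq: "(\<lambda>n. c / (real (Suc n))\<^sup>2) \<longlonglongrightarrow> 0" for c :: real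
  proof -
    have "(\<lambda>n. c * (inverse (real (Suc n)))\<^sup>2) \<longlonglongrightarrow> c * 0\<^sup>2"
      by (intro tendsto_intros LIMSEQ_inverse_real_of_nat)
    then show ?thesis by (simp add: divide_inverse power_inverse)
  qed
  have "(\<lambda>n. \<integral>z. min 1 ((norm z)\<^sup>2 / (real (Suc n))\<^sup>2) \<partial>N) \<longlonglongrightarrow> (\<integral>z. 0 \<partial>N)"
  proof (rule integral_dominated_convergence[where w="\<lambda>z. min 1 ((norm z)\<^sup>2 / 1\<^sup>2)"])
    show "integrable N (\<lambda>z. min 1 ((norm z)\<^sup>2 / 1\<^sup>2))" by (rule integrable_h) simp
    have "(\<lambda>n. min 1 ((norm z)\<^sup>2 / (real (Suc n))\<^sup>2)) \<longlonglongrightarrow> min 1 0" for z :: "real^'d"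
      by (intro tendsto_min tendsto_const sq)
    then show "AE z in N. (\<lambda>n. min 1 ((norm z)\<^sup>2 / (real (Suc n))\<^sup>2)) \<longlonglongrightarrow> 0"
      by (intro AE_I2) (simp del: of_nat_Suc)
    have "min 1 ((norm z)\<^sup>2 / (real (Suc n))\<^sup>2) \<le> min 1 ((norm z)\<^sup>2 / 1\<^sup>2)" for z :: "real^'d" and n
      by (intro min.mono divide_left_mono power_mono) (auto simp del: of_nat_Suc)
    then show "AE z in N. norm (min 1 ((norm z)\<^sup>2 / (real (Suc n))\<^sup>2)) \<le> min 1 ((norm z)\<^sup>2 / 1\<^sup>2)" for n
      by (auto simp del: of_nat_Suc)
  qed measurable
  from tendsto_add[OF sq[of "onorm ((*v) A)"] this] show ?thesis by (simp add: hfun_def)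
qed

lemma hinv_h:
  assumes "0 < r"
  shows "hinv A N (h r) = r"
  unfolding hinv_def
proof (rule the_equality)
  show "0 < u \<and> h u = h r \<Longrightarrow> u = r" for u
    using h_less_iff[of u r] h_less_iff[of r u] assms by force
qed (use assms in simp)

lemma
  assumes s: "0 < s"
  shows hinv_pos: "0 < hinv A N s" and h_hinv: "h (hinv A N s) = s"
proof -
  obtain n where n: "h (real (Suc n)) < s"
    using order_tendstoD(2)[OF h_tendsto_0 s] eventually_happens'[OF sequentially_bot] by blast
  obtain u where u: "0 < u" "u < real (Suc n)" "s < h u" by (rule h_exceeds[of "real (Suc n)"]) auto
  have "\<exists>r\<ge>u. r \<le> real (Suc n) \<and> h r = s"
    using n u by (intro IVT2) (auto intro!: h_continuous)
  then obtain r where "u \<le> r" "h r = s" by blast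
  then have "0 < r" "h r = s" using u by auto
  then show "0 < hinv A N s" "h (hinv A N s) = s" using hinv_h[of r] by auto
qed

end

section \<open>Integral bounds, decay and nondegeneracy\<close>

context unbounded_levy_triplet begin

abbreviation exp_int :: "real \<Rightarrow> ennreal" where
  "exp_int t \<equiv> (\<integral>\<^sup>+z. ennreal (exp (- t * re_psi z)) \<partial>lborel)"

text \<open>A scaling condition at infinity. In terms of the inverse it says that, for large t,
  doubling t enlarges \<open>hinv A N (1 / t)\<close> at most m-fold. The bound m \<ge> 2 keeps the
  exponent ln 2 / ln m at most 1.\<close>

definition h_decay :: bool where
  "h_decay \<longleftrightarrow> (\<exists>R>0. \<exists>m\<ge>2. \<forall>r>R. h (m * r) \<le> h r / 2)"

definition nondegenerate :: bool where
  "nondegenerate \<longleftrightarrow> (\<exists>R>0. \<exists>c>0. \<forall>x. x \<noteq> 0 \<and> norm x < 1 / R \<longrightarrow> c * h (1 / norm x) \<le> re_psi x)"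

text \<open>Iteration gives h (m^n r) \<le> h r / 2^n. With \<alpha> = ln 2 / ln m one has
  m^\<alpha> = 2, and the leading factor 2 pays for rounding log_m (s / r) down to an
  integer.\<close>

lemma h_decay_powr:
  assumes "h_decay"
  obtains R \<alpha> where "0 < R" "0 < \<alpha>" "\<alpha> \<le> 1" "\<And>r s. R < r \<Longrightarrow> r \<le> s \<Longrightarrow> h s \<le> 2 * (r / s) powr \<alpha> * h r"
proof -
  obtain R m where R: "0 < R" and m: "2 \<le> m" and dec: "\<And>r. R < r \<Longrightarrow> h (m * r) \<le> h r / 2"
    using assms unfolding h_decay_def by blast
  define \<alpha> where "\<alpha> = ln 2 / ln m"
  have lnm: "0 < ln m" "ln 2 \<le> ln m" using m by auto
  then have \<alpha>: "0 < \<alpha>" "\<alpha> \<le> 1" by (auto simp: \<alpha>_def)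
  have m\<alpha>: "m powr \<alpha> = 2" using lnm m by (simp add: \<alpha>_def powr_def)
  have pow: "h (m ^ n * r) \<le> h r / 2 ^ n" if r: "R < r" for n r
  proof (induction n)
    case (Suc n)
    have "1 * r \<le> m ^ n * r" using m r R by (intro mult_right_mono) auto
    then have "h (m * (m ^ n * r)) \<le> h (m ^ n * r) / 2" using r by (intro dec) simp
    then show ?case using Suc by (simp add: mult.assoc)
  qed simp
  have "h s \<le> 2 * (r / s) powr \<alpha> * h r" if r: "R < r" and s: "r \<le> s" for r s
  proof -
    have pos: "0 < r" "0 < s" using r s R by auto
    define n where "n = nat \<lfloor>log m (s / r)\<rfloor>"
    have "0 \<le> log m (s / r)" using pos s m by simp
    then have "real n = of_int \<lfloor>log m (s / r)\<rfloor>" by (simp add: n_def)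
    then have n: "real n \<le> log m (s / r)" "log m (s / r) < real (Suc n)"
      using floor_correct[of "log m (s / r)"] unfolding of_nat_Suc of_int_add of_int_1 by linarith+
    have "m powr real n \<le> s / r" "s / r < m powr real (Suc n)"
      using n pos m by (auto simp: le_log_iff log_less_iff simp del: of_nat_Suc)
    then have nn: "m ^ n \<le> s / r" "s / r < m ^ Suc n" using m by (simp_all add: powr_realpow del: of_nat_Suc power_Suc)
    have "h s \<le> h (m ^ n * r)" using nn pos m by (intro h_antimono) (auto simp: field_simps)
    also have "\<dots> \<le> 2 * (1 / 2 ^ Suc n) * h r" using pow[OF r, of n] by simp
    also have "\<dots> \<le> 2 * (r / s) powr \<alpha> * h r"
    proof -
      have "(s / r) powr \<alpha> \<le> (m ^ Suc n) powr \<alpha>"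
        using nn(2) pos \<alpha> by (intro powr_mono2) (auto simp del: power_Suc)
      also have "\<dots> = 2 ^ Suc n"
        using m by (simp only: powr_realpow[symmetric] powr_powr) (simp add: mult.commute powr_powr[symmetric] m\<alpha> powr_realpow del: of_nat_Suc power_Suc)
      finally have "1 / 2 ^ Suc n \<le> 1 / (s / r) powr \<alpha>"
        using pos by (intro divide_left_mono) auto
      also have "\<dots> = (r / s) powr \<alpha>" using pos by (simp add: powr_divide)
      finally show ?thesis using h_pos[OF pos(1)] by (intro mult_right_mono mult_left_mono) auto
    qed
    finally show ?thesis .
  qed
  with R \<alpha> show thesis by (rule that)
qed

lemma exp_int_ball_lower:
  assumes "0 < \<rho>" "\<And>z. norm z < \<rho> \<Longrightarrow> t * re_psi z \<le> c"
  shows "ennreal (unit_ball_vol (real CARD('d)) * \<rho> ^ CARD('d) * exp (- c)) \<le> exp_int t"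
proof -
  let ?B = "ball (0::real^'d) \<rho>"
  have "ennreal (unit_ball_vol (real CARD('d)) * \<rho> ^ CARD('d) * exp (- c)) = ennreal (exp (- c)) * emeasure lborel ?B"
    using assms(1) by (simp add: emeasure_ball mult_ac flip: ennreal_mult')
  also have "\<dots> = (\<integral>\<^sup>+z. ennreal (exp (- c)) * indicator ?B z \<partial>lborel)"
    by (rule nn_integral_cmult_indicator[symmetric]) auto
  also have "\<dots> \<le> exp_int t"
  proof (rule nn_integral_mono)
    fix z :: "real^'d"
    show "ennreal (exp (- c)) * indicator ?B z \<le> ennreal (exp (- t * re_psi z))"
      using assms(2)[of z] by (cases "z \<in> ?B") (simp_all add: ennreal_leI)
  qed
  finally show ?thesis .
qed

lemma exp_int_antimono:
  assumes "s \<le> t"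
  shows "exp_int t \<le> exp_int s"
  using assms re_psi_nonneg by (intro nn_integral_mono ennreal_leI) (auto intro!: mult_right_mono)

section \<open>Consequences of the integral bound at doubled time\<close>

context
  fixes T C :: real
  assumes T: "0 < T" and C: "0 < C"
    and bound: "\<And>t. T < t \<Longrightarrow> exp_int (2 * t) \<le> ennreal (C * hinv A N (1 / t) powr (- real CARD('d)))"
begin

text \<open>Taking t = 1 / h r removes the inverse, since \<open>hinv A N (1 / t)\<close> is then r;
  the condition on r amounts to T < t.\<close>

lemma exp_int_bound_radius:
  assumes "hinv A N (1 / T) < r"
  shows "exp_int (2 / h r) \<le> ennreal (C / r ^ CARD('d))"
proof -
  have r: "0 < r" using assms hinv_pos[of "1 / T"] T by simp
  have "h r < 1 / T" using h_strict_antimono[OF hinv_pos assms] h_hinv T by simp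
  then have "T < 1 / h r" using T h_pos[OF r] by (simp add: field_simps)
  from bound[OF this] show ?thesis
    using r by (simp add: hinv_h powr_minus powr_realpow divide_inverse)
qed

text \<open>If h fell by less than half from r to m r, then at t = 1 / h (m r) the exponent 2 t Re
  Psi would be at most 8 on the whole ball of radius 1 / r. The volume V r^(-d) of that ball
  contradicts the bound C (m r)^(-d) once m^d exceeds C e^8 / V, which the choice of m ensures
  because m \<le> m^d.\<close>

lemma bound_imp_h_decay: h_decay
proof -
  define V where "V = unit_ball_vol (real CARD('d))"
  have V: "0 < V" by (simp add: V_def)
  define m where "m = max 2 (C * exp 8 / V + 1)"
  have m: "2 \<le> m" "C * exp 8 < V * m"
    using V by (auto simp: m_def max_def field_simps split: if_splits)
  have R: "0 < hinv A N (1 / T)" using T by (intro hinv_pos) simp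
  have "h (m * r) \<le> h r / 2" if r: "hinv A N (1 / T) < r" for r
  proof (rule ccontr)
    assume "\<not> h (m * r) \<le> h r / 2"
    then have less: "h r < 2 * h (m * r)" by simp
    have r0: "0 < r" using r R by simp
    then have "1 * r \<le> m * r" using m by (intro mult_right_mono) auto
    then have mr: "0 < m * r" "hinv A N (1 / T) < m * r"
      using r r0 by linarith+
    have "ennreal (V * (1 / r) ^ CARD('d) * exp (- 8)) \<le> exp_int (2 / h (m * r))"
      unfolding V_def
    proof (rule exp_int_ball_lower)
      fix z :: "real^'d" assume "norm z < 1 / r"
      then have "re_psi z \<le> 2 * h r" using r0 by (intro re_psi_le_h) auto
      then have "re_psi z \<le> 4 * h (m * r)" using less by simp
      then show "2 / h (m * r) * re_psi z \<le> 8" using h_pos[OF mr(1)] by (simp add: field_simps)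
    qed (use r0 in simp)
    also have "\<dots> \<le> ennreal (C / (m * r) ^ CARD('d))" by (rule exp_int_bound_radius) fact
    finally have "V * (1 / r) ^ CARD('d) * exp (- 8) \<le> C / (m * r) ^ CARD('d)"
      using C mr by (simp add: ennreal_le_iff)
    then have "V * m ^ CARD('d) \<le> C * exp 8"
      using r0 m by (simp add: field_simps exp_minus power_mult_distrib)
    moreover have "m ^ 1 \<le> m ^ CARD('d)" using m by (intro power_increasing) auto
    then have "V * m \<le> V * m ^ CARD('d)" using V by simp
    ultimately show False using m by simp
  qed
  then show ?thesis using R m unfolding h_decay_def by blast
qed

text \<open>Were Re Psi x much smaller than h (1 / |x|), n disjoint balls of radius |x| / 2 would
  contribute n times a fixed multiple of |x|^d, while the bound allows only C |x|^d.\<close>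

lemma bound_imp_nondegenerate: nondegenerate
proof -
  define V where "V = unit_ball_vol (real CARD('d))"
  have V: "0 < V" by (simp add: V_def)
  \<comment> \<open>The exponent 10 is 2 * 1 + 2 * 4: the centres contribute at most 1, and Re Psi
    \<le> 2 h gives 4 for the displacement. The factor 2^d undoes the halved radius.\<close>
  obtain n where n: "C * 2 ^ CARD('d) * exp 10 / V < real n" using reals_Archimedean2 by blast
  have n0: "0 < real n" by (rule le_less_trans[OF _ n]) (use C V in auto)
  define R where "R = hinv A N (1 / T)"
  have R: "0 < R" unfolding R_def using T by (intro hinv_pos) simp
  have "1 / (2 * (real n)\<^sup>2) * h (1 / norm x) \<le> re_psi x" if x: "x \<noteq> 0" "norm x < 1 / R" for x
  proof (rule ccontr)
    define r where "r = 1 / norm x"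
    have r: "0 < r" "R < r" using x R by (auto simp: r_def field_simps)
    assume "\<not> 1 / (2 * (real n)\<^sup>2) * h (1 / norm x) \<le> re_psi x"
    then have "(real n)\<^sup>2 * (2 / h r * re_psi x) \<le> 1"
      using h_pos[OF r(1)] n0 by (simp add: field_simps r_def)
    then have "ennreal (real n * (V * (norm x / 2) ^ CARD('d)) * exp (- (2 * 1 + 2 * 4))) \<le> exp_int (2 / h r)"
      unfolding V_def
    proof (intro nn_integral_exp_re_psi_lower)
      fix y :: "real^'d" assume "norm y < norm x / 2"
      then have "norm y \<le> 1 / r" using norm_ge_zero[of y] unfolding r_def by (simp only: divide_divide_eq_right div_by_1 mult_1)
      then have "re_psi y \<le> 2 * h r" by (rule re_psi_le_h[OF r(1)])
      then show "2 / h r * re_psi y \<le> 4" using h_pos[OF r(1)] by (simp add: field_simps)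
    qed (use x h_pos[OF r(1)] in auto)
    also have "\<dots> \<le> ennreal (C / r ^ CARD('d))" using r unfolding R_def by (intro exp_int_bound_radius)
    finally have "real n * (V * (norm x / 2) ^ CARD('d)) * exp (- 10) \<le> C / r ^ CARD('d)"
      using C r by (simp add: ennreal_le_iff)
    then have "real n * V \<le> C * 2 ^ CARD('d) * exp 10"
      using x by (simp add: field_simps exp_minus r_def power_divide)
    then show False using n V by (simp add: field_simps)
  qed
  then show ?thesis unfolding nondegenerate_def using R n0
    by (intro exI[of _ R] conjI exI[of _ "1 / (2 * (real n)\<^sup>2)"]) auto
qed

lemma bound_imp_exp_int_finite: "\<exists>t0>0. exp_int t0 < \<infinity>"
  using bound[of "T + 1"] T by (intro exI[of _ "2 * (T + 1)"]) (auto simp: less_top intro: le_less_trans)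

end

text \<open>Integrability at one time is enough: if Re Psi were tiny at some x with |x| \<ge> 1 / R,
  then n balls around its multiples would each add the amount E to the finite integral I. The radius
  1 / (2 R) and hence E do not depend on x, so \<delta> is uniform.\<close>

lemma re_psi_bounded_away:
  assumes t0: "0 < t0" "exp_int t0 < \<infinity>" and R: "0 < R"
  obtains \<delta> where "0 < \<delta>" "\<And>x. 1 / R \<le> norm x \<Longrightarrow> \<delta> \<le> re_psi x"
proof -
  define V where "V = unit_ball_vol (real CARD('d))"
  have V: "0 < V" by (simp add: V_def)
  obtain I where I: "exp_int t0 = ennreal I" "0 \<le> I" using t0 by (cases "exp_int t0") auto
  define \<rho> where "\<rho> = 1 / (2 * R)"
  have \<rho>: "0 < \<rho>" using R by (simp add: \<rho>_def)
  define c where "c = t0 * (2 * h (2 * R))"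
  define E where "E = V * \<rho> ^ CARD('d) * exp (- (2 * 1 + 2 * c))"
  have E: "0 < E" using V \<rho> by (simp add: E_def)
  obtain n where n: "I / E < real n" using reals_Archimedean2 by blast
  have n0: "0 < real n" by (rule le_less_trans[OF _ n]) (use I E in auto)
  have "1 / ((real n)\<^sup>2 * t0) \<le> re_psi x" if x: "1 / R \<le> norm x" for x
  proof (rule ccontr)
    assume "\<not> 1 / ((real n)\<^sup>2 * t0) \<le> re_psi x"
    then have "(real n)\<^sup>2 * (t0 * re_psi x) \<le> 1" using n0 t0 by (simp add: field_simps)
    then have "ennreal (real n * (V * \<rho> ^ CARD('d)) * exp (- (2 * 1 + 2 * c))) \<le> exp_int t0"
      unfolding V_def
    proof (intro nn_integral_exp_re_psi_lower)
      fix y :: "real^'d" assume "norm y < \<rho>"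
      then have "re_psi y \<le> 2 * h (2 * R)" using R by (intro re_psi_le_h) (auto simp: \<rho>_def)
      then show "t0 * re_psi y \<le> c" unfolding c_def using t0 by (intro mult_left_mono) auto
    qed (use x \<rho> t0 in \<open>auto simp: \<rho>_def\<close>)
    then have "real n * E \<le> I" using I by (simp add: E_def ennreal_le_iff mult_ac)
    then show False using n E by (simp add: field_simps)
  qed
  then show thesis using that[of "1 / ((real n)\<^sup>2 * t0)"] n0 t0 by simp
qed

text \<open>With r = \<open>hinv A N (1 / t)\<close>, the identity t h r = 1 turns decay and
  nondegeneracy into t Re Psi z \<ge> (c / 2) (|z| r)^\<alpha> for 1 / r < |z| < 1 / R. For larger z
  an exponentially small factor has to beat r^(-d); this needs an upper bound on r in terms of t,
  again supplied by the decay of h.\<close>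

lemma exp_int_upper:
  assumes h_decay nondegenerate and t0: "0 < t0" "exp_int t0 < \<infinity>"
  shows "\<exists>T>0. \<exists>C>0. \<forall>t>T. exp_int t \<le> ennreal (C * hinv A N (1 / t) powr (- real CARD('d)))"
proof -
  let ?D = "CARD('d)"
  obtain R1 \<alpha> where R1: "0 < R1" and \<alpha>: "0 < \<alpha>" "\<alpha> \<le> 1"
    and dec: "\<And>r s. R1 < r \<Longrightarrow> r \<le> s \<Longrightarrow> h s \<le> 2 * (r / s) powr \<alpha> * h r"
    using h_decay_powr[OF \<open>h_decay\<close>] by blast
  obtain R2 c where R2: "0 < R2" and c: "0 < c"
    and nd: "\<And>x. x \<noteq> 0 \<Longrightarrow> norm x < 1 / R2 \<Longrightarrow> c * h (1 / norm x) \<le> re_psi x"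
    using \<open>nondegenerate\<close> unfolding nondegenerate_def by blast
  define R where "R = max R1 R2"
  have R: "0 < R" "R1 \<le> R" "R2 \<le> R" using R1 by (auto simp: R_def)
  obtain \<delta> where \<delta>: "0 < \<delta>" "\<And>x. 1 / R \<le> norm x \<Longrightarrow> \<delta> \<le> re_psi x"
    using re_psi_bounded_away[OF t0 R(1)] by blast
  obtain I where I: "exp_int t0 = ennreal I" "0 \<le> I" using t0 by (cases "exp_int t0") auto
  \<comment> \<open>Half of c, because the decay estimate carries a leading 2.\<close>
  define a where "a = c / 2"
  have a: "0 < a" using c by (simp add: a_def)
  obtain J where J: "0 < J" and Jle: "\<And>r. 0 < r \<Longrightarrow>
      (\<integral>\<^sup>+z. ennreal (exp (- a * (norm (z::real^'d) * r) powr \<alpha>)) \<partial>lborel) \<le> ennreal (J * r powr (- real ?D))"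
    using nn_integral_stretched_exp_le[OF a \<alpha>(1), where 'a="real^'d"] by auto
  \<comment> \<open>A reference radius strictly above \<open>R1\<close>, where the decay estimate
    starts to apply.\<close>
  define r1 where "r1 = R + 1"
  have r1: "0 < r1" "R1 < r1" using R by (auto simp: r1_def)
  define K where "K = 2 * r1 powr \<alpha> * h r1"
  have K: "0 < K" using h_pos[OF r1(1)] r1 by (simp add: K_def)
  obtain T0 where T0: "\<And>t. T0 \<le> t \<Longrightarrow> exp (- (\<delta> * t)) * (K * t) powr (real ?D / \<alpha>) \<le> 1"
    using eventually_exp_beats_powr[OF K, of "real ?D / \<alpha>" \<delta>] \<alpha> \<delta>(1)
    by (auto simp: eventually_at_top_linorder)
  define T where "T = max t0 (max T0 (1 / h r1))"
  define C where "C = exp a * J + exp (\<delta> * t0) * I"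
  have "0 < C" using J I by (simp add: C_def add_pos_nonneg)
  have "exp_int t \<le> ennreal (C * hinv A N (1 / t) powr (- real ?D))" if "T < t" for t
  proof -
    have t: "0 < t" "t0 < t" "T0 < t" "1 / h r1 < t" using that t0 by (auto simp: T_def)
    define r where "r = hinv A N (1 / t)"
    have r: "0 < r" "h r = 1 / t" unfolding r_def using t by (auto intro!: hinv_pos h_hinv)
    have "1 / t < h r1" using t h_pos[OF r1(1)] by (simp add: field_simps)
    then have "h r < h r1" using r by simp
    then have "r1 < r" using h_less_iff[OF r(1) r1(1)] by simp
    have pointwise: "exp (- t * re_psi z) \<le> exp a * exp (- a * (norm z * r) powr \<alpha>) + exp (- \<delta> * (t - t0)) * exp (- t0 * re_psi z)" for z
    proof (cases "norm z < 1 / R")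
      case True
      have "exp (- t * re_psi z) \<le> exp (a - a * (norm z * r) powr \<alpha>)"
      \<comment> \<open>For |z| r \<le> 1 there is no decay to exploit; the factor
        \<open>exp a\<close> makes the claimed bound at least 1 there.\<close>
      proof (cases "norm z * r \<le> 1")
        case True
        then have "(norm z * r) powr \<alpha> \<le> 1" using \<alpha> r by (intro powr_le1) auto
        then have "a * (norm z * r) powr \<alpha> \<le> a * 1" using a by (intro mult_left_mono) auto
        moreover have "0 \<le> t * re_psi z" using t re_psi_nonneg[of z] by simp
        ultimately show ?thesis by simp
      next
        case False
        then have z: "z \<noteq> 0" by auto
        then have nz: "0 < norm z" by simp
        have "R1 \<le> R" by (rule R)
        also have "R < 1 / norm z" using True R nz by (simp add: field_simps)
        finally have "R1 < 1 / norm z" .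
        moreover have "1 / norm z \<le> r" using False nz by (simp add: field_simps)
        ultimately have "1 / t \<le> 2 * (1 / norm z / r) powr \<alpha> * h (1 / norm z)"
          using dec[of "1 / norm z" r] r by simp
        also have "(1 / norm z / r) powr \<alpha> = 1 / (norm z * r) powr \<alpha>"
          using nz r by (simp add: powr_divide powr_mult)
        finally have "(norm z * r) powr \<alpha> \<le> 2 * (t * h (1 / norm z))"
          using t nz r by (simp add: field_simps)
        then have "a * (norm z * r) powr \<alpha> \<le> t * (c * h (1 / norm z))"
          using a by (simp add: a_def field_simps)
        also have "\<dots> \<le> t * re_psi z"
        proof -
          have "1 / R \<le> 1 / R2" using R R2 by (intro divide_left_mono) auto
          then show ?thesis using t True by (intro mult_left_mono nd z) auto
        qed
        finally show ?thesis using a by simp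
      qed
      also have "\<dots> = exp a * exp (- a * (norm z * r) powr \<alpha>)" by (simp add: exp_diff exp_minus divide_inverse)
      finally show ?thesis by (simp add: add_increasing2)
    next
      case False
      then have "\<delta> * (t - t0) \<le> re_psi z * (t - t0)" using \<delta> t by (intro mult_right_mono) auto
      then have "exp (- t * re_psi z) \<le> exp (- \<delta> * (t - t0)) * exp (- t0 * re_psi z)"
        unfolding exp_add[symmetric] by (simp add: algebra_simps)
      then show ?thesis by (simp add: add_increasing)
    qed
    \<comment> \<open>Decay from \<open>r1\<close> to r gives r^\<alpha> \<le> K t, so r^d is at
      most a power of t, which exp (\<delta> t) outgrows.\<close>
    have rD: "exp (- (\<delta> * t)) \<le> r powr (- real ?D)"
    proof -
      have "1 / t \<le> 2 * (r1 / r) powr \<alpha> * h r1" using dec[of r1 r] r1 r \<open>r1 < r\<close> by simp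
      also have "\<dots> = K / r powr \<alpha>" using r1 r by (simp add: K_def powr_divide)
      finally have "r powr \<alpha> \<le> K * t" using t r by (simp add: field_simps)
      then have "(r powr \<alpha>) powr (real ?D / \<alpha>) \<le> (K * t) powr (real ?D / \<alpha>)"
        using \<alpha> by (intro powr_mono2) auto
      then have "r powr real ?D \<le> (K * t) powr (real ?D / \<alpha>)" using \<alpha> by (simp add: powr_powr)
      then have "exp (- (\<delta> * t)) * r powr real ?D \<le> exp (- (\<delta> * t)) * (K * t) powr (real ?D / \<alpha>)"
        by (intro mult_left_mono) auto
      also have "\<dots> \<le> 1" using T0[of t] t by simp
      finally show ?thesis using r by (simp add: powr_minus field_simps)
    qed
    have "exp_int t \<le> (\<integral>\<^sup>+z. ennreal (exp a) * ennreal (exp (- a * (norm z * r) powr \<alpha>)) + ennreal (exp (- \<delta> * (t - t0))) * ennreal (exp (- t0 * re_psi z)) \<partial>lborel)"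
      by (intro nn_integral_mono) (simp only: ennreal_mult'[symmetric] exp_ge_zero ennreal_plus[symmetric] mult_nonneg_nonneg ennreal_leI[OF pointwise])
    also have "\<dots> = ennreal (exp a) * (\<integral>\<^sup>+z. ennreal (exp (- a * (norm (z::real^'d) * r) powr \<alpha>)) \<partial>lborel) + ennreal (exp (- \<delta> * (t - t0))) * exp_int t0"
      by (subst nn_integral_add) (auto simp: nn_integral_cmult)
    also have "\<dots> \<le> ennreal (exp a) * ennreal (J * r powr (- real ?D)) + ennreal (exp (- \<delta> * (t - t0))) * ennreal I"
      unfolding I by (intro add_mono mult_left_mono Jle r) auto
    also have "\<dots> = ennreal (exp a * (J * r powr (- real ?D)) + exp (- \<delta> * (t - t0)) * I)"
      using J I by (simp add: ennreal_mult' ennreal_plus)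
    also have "\<dots> \<le> ennreal (C * r powr (- real ?D))"
    proof (rule ennreal_leI)
      have "exp (- \<delta> * (t - t0)) * I = exp (\<delta> * t0) * I * exp (- (\<delta> * t))"
        by (simp add: algebra_simps exp_add[symmetric] exp_diff exp_minus divide_inverse)
      also have "\<dots> \<le> exp (\<delta> * t0) * I * r powr (- real ?D)" using rD I by (intro mult_left_mono) auto
      finally show "exp a * (J * r powr (- real ?D)) + exp (- \<delta> * (t - t0)) * I \<le> C * r powr (- real ?D)"
        by (simp add: C_def algebra_simps)
    qed
    finally show ?thesis unfolding r_def .
  qed
  moreover have "0 < T" using t0 by (simp add: T_def)
  ultimately show ?thesis using \<open>0 < C\<close> by blast
qed


section \<open>Conditions (D3) and (D4) in terms of h\<close>

lemma weak_scaling_iff: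
  "(\<exists>T>0. \<exists>c. 0 < c \<and> c \<le> 1 \<and> (\<exists>\<alpha>. 0 < \<alpha> \<and> \<alpha> \<le> 2 \<and>
      (\<forall>x. norm x < 1 / T \<longrightarrow> c * psi_star \<Psi> (norm x) \<le> Re (\<Psi> x)) \<and>
      (\<forall>l r. 0 < l \<and> l \<le> 1 \<and> 0 < r \<and> r < 1 / T \<longrightarrow>
         psi_star \<Psi> (l * r) \<le> (1 / c) * l powr \<alpha> * psi_star \<Psi> r)))
    \<longleftrightarrow> h_decay \<and> nondegenerate" (is "?L \<longleftrightarrow> ?R")
proof
  assume ?L
  then obtain T c \<alpha> where T: "0 < T" and c: "0 < c" and \<alpha>: "0 < \<alpha>"
    and nd: "\<And>x. norm x < 1 / T \<Longrightarrow> c * psi_star \<Psi> (norm x) \<le> re_psi x"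
    and sc: "\<And>l r. 0 < l \<Longrightarrow> l \<le> 1 \<Longrightarrow> 0 < r \<Longrightarrow> r < 1 / T \<Longrightarrow> psi_star \<Psi> (l * r) \<le> (1 / c) * l powr \<alpha> * psi_star \<Psi> r"
    unfolding Re_exponent by blast
  define k where "k = cmp_const"
  have k: "0 < k" unfolding k_def by (rule cmp_const_pos)
  have "c / k * h (1 / norm x) \<le> re_psi x" if x: "x \<noteq> 0" "norm x < 1 / T" for x
  proof -
    have "c / k * h (1 / norm x) \<le> c / k * (k * psi_star \<Psi> (norm x))"
      unfolding k_def using x c cmp_const_pos by (intro mult_left_mono h_le_psi_star) auto
    also have "\<dots> = c * psi_star \<Psi> (norm x)" using k by simp
    also have "\<dots> \<le> re_psi x" by (rule nd[OF x(2)])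
    finally show ?thesis .
  qed
  then have "nondegenerate"
    unfolding nondegenerate_def using T c k by (intro exI[of _ T] exI[of _ "c / k"] conjI) auto
  moreover have h_decay
  proof -
    \<comment> \<open>The choice makes 2 (k / c) l^\<alpha> at most 1/2, where k and 2 are the
      constants of the two-sided comparison of \<open>psi_star\<close> with h. The cap 1/2 ensures
      that the dilation 1 / l is at least 2.\<close>
    define l where "l = min (1 / 2) ((c / (4 * k)) powr (1 / \<alpha>))"
    have l: "0 < l" "l \<le> 1 / 2" using c k by (auto simp: l_def)
    have "l powr \<alpha> \<le> ((c / (4 * k)) powr (1 / \<alpha>)) powr \<alpha>"
      using l \<alpha> by (intro powr_mono2) (auto simp: l_def)
    also have "\<dots> = c / (4 * k)" using \<alpha> c k by (simp add: powr_powr)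
    finally have l\<alpha>: "l powr \<alpha> \<le> c / (4 * k)" .
    have "h (1 / l * r) \<le> h r / 2" if r: "T < r" for r
    proof -
      have r0: "0 < r" using r T by simp
      have "h (1 / l * r) = h (1 / (l * (1 / r)))" by simp
      also have "\<dots> \<le> k * psi_star \<Psi> (l * (1 / r))"
        unfolding k_def using l r0 by (intro h_le_psi_star) auto
      also have "\<dots> \<le> k * ((1 / c) * l powr \<alpha> * psi_star \<Psi> (1 / r))"
        using k l r r0 T by (intro mult_left_mono sc) (auto simp: field_simps)
      also have "\<dots> \<le> k * ((1 / c) * (c / (4 * k)) * (2 * h (1 / (1 / r))))"
        using k c r0 l\<alpha> psi_star_nonneg[of "1 / r"] psi_star_le_h[of "1 / r"]
        by (intro mult_left_mono mult_mono) auto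
      also have "\<dots> = h r / 2" using k c by simp
      finally show ?thesis .
    qed
    then show ?thesis unfolding h_decay_def using T l
      by (intro exI[of _ T] exI[of _ "1 / l"] conjI) (auto simp: field_simps)
  qed
  ultimately show ?R by simp
next
  assume R: ?R
  obtain R1 \<alpha> where R1: "0 < R1" and \<alpha>: "0 < \<alpha>" "\<alpha> \<le> 1"
    and dec: "\<And>r s. R1 < r \<Longrightarrow> r \<le> s \<Longrightarrow> h s \<le> 2 * (r / s) powr \<alpha> * h r"
    using h_decay_powr R by blast
  obtain R2 c where R2: "0 < R2" and c: "0 < c"
    and nd: "\<And>x. x \<noteq> 0 \<Longrightarrow> norm x < 1 / R2 \<Longrightarrow> c * h (1 / norm x) \<le> re_psi x"
    using R unfolding nondegenerate_def by blast
  define k where "k = cmp_const"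
  have k: "0 < k" unfolding k_def by (rule cmp_const_pos)
  define T where "T = max R1 R2"
  have T: "0 < T" using R1 by (simp add: T_def)
  have T1: "1 / T \<le> 1 / R1" and T2: "1 / T \<le> 1 / R2"
    using R1 R2 by (auto simp: T_def intro!: divide_left_mono)
  \<comment> \<open>The term c / 2 absorbs the 2 in \<open>psi_star_le_h\<close>; the term 1 / (4 *
    k) absorbs that 2, the 2 of the decay estimate and the k of the reverse comparison.\<close>
  define c3 where "c3 = min 1 (min (c / 2) (1 / (4 * k)))"
  have c3: "0 < c3" "c3 \<le> 1" "c3 \<le> c / 2" "c3 \<le> 1 / (4 * k)"
    using c k by (auto simp: c3_def)
  then have c3k: "4 * k \<le> 1 / c3" using k by (simp add: field_simps)
  have "c3 * psi_star \<Psi> (norm x) \<le> Re (\<Psi> x)" if x: "norm x < 1 / T" for x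
  proof (cases "x = 0")
    case False
    have "c3 * psi_star \<Psi> (norm x) \<le> c / 2 * (2 * h (1 / norm x))"
      using c3 c False by (intro mult_mono psi_star_le_h psi_star_nonneg) auto
    also have "\<dots> \<le> re_psi x" using nd[OF False] x T2 by simp
    finally show ?thesis by (simp add: Re_exponent)
  qed (simp add: psi_star_0 Re_exponent re_psi_0)
  moreover have "psi_star \<Psi> (l * r) \<le> (1 / c3) * l powr \<alpha> * psi_star \<Psi> r"
    if l: "0 < l" "l \<le> 1" and r: "0 < r" "r < 1 / T" for l r
  proof -
    have "psi_star \<Psi> (l * r) \<le> 2 * h (1 / (l * r))" using l r by (intro psi_star_le_h) auto
    also have "h (1 / (l * r)) \<le> 2 * ((1 / r) / (1 / (l * r))) powr \<alpha> * h (1 / r)"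
    proof (rule dec)
      have "r < 1 / R1" using r T1 by simp
      then show "R1 < 1 / r" using R1 r by (simp add: field_simps)
      show "1 / r \<le> 1 / (l * r)" using l r by (simp add: field_simps)
    qed
    also have "(1 / r) / (1 / (l * r)) = l" using r by simp
    also have "2 * (2 * l powr \<alpha> * h (1 / r)) \<le> 2 * (2 * l powr \<alpha> * (k * psi_star \<Psi> r))"
      unfolding k_def using r by (intro mult_left_mono h_le_psi_star) auto
    also have "\<dots> = 4 * k * (l powr \<alpha> * psi_star \<Psi> r)" by simp
    also have "\<dots> \<le> (1 / c3) * (l powr \<alpha> * psi_star \<Psi> r)"
      using c3k psi_star_nonneg[OF r(1)] by (intro mult_right_mono) auto
    finally show ?thesis by (simp add: mult.assoc)
  qed
  ultimately show ?L
    using T c3 \<alpha> by (intro exI[of _ T] conjI exI[of _ c3] exI[of _ \<alpha>]) auto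
qed

text \<open>If \<open>dir_K\<close> bounds h, each doubling of the radius costs a fixed share of
  \<open>dir_h\<close>, so it decays geometrically. Conversely, decay and nondegeneracy make some
  dilation l cost half of \<open>dir_h\<close>, and \<open>dir_h_diff_le\<close> converts this loss
  into a lower bound for \<open>dir_K\<close>.\<close>

lemma truncated_moment_iff:
  "(\<exists>T>0. \<exists>c\<ge>1. \<forall>x. norm x < 1 / T \<longrightarrow> psi_star \<Psi> (norm x) \<le> c * dir_K x)
    \<longleftrightarrow> h_decay \<and> nondegenerate" (is "?L \<longleftrightarrow> ?R")
proof
  assume ?L
  then obtain T c where T: "0 < T" and c: "1 \<le> c"
    and le: "\<And>x. norm x < 1 / T \<Longrightarrow> psi_star \<Psi> (norm x) \<le> c * dir_K x" by blast
  define k where "k = cmp_const * c"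
  have k: "2 \<le> k"
    using c mult_mono[of 2 cmp_const 1 c] by (simp add: k_def cmp_const_def)
  have hK: "h (1 / norm x) \<le> k * dir_K x" if x: "x \<noteq> 0" "norm x < 1 / T" for x
  proof -
    have "h (1 / norm x) \<le> cmp_const * psi_star \<Psi> (norm x)" using x by (intro h_le_psi_star) auto
    also have "\<dots> \<le> cmp_const * (c * dir_K x)" using cmp_const_pos by (intro mult_left_mono le x) auto
    finally show ?thesis by (simp add: k_def)
  qed
  have "1 / (4 * k) * h (1 / norm x) \<le> re_psi x" if x: "x \<noteq> 0" "norm x < 1 / T" for x
  proof -
    have "h (1 / norm x) \<le> k * dir_K x" by (rule hK[OF x])
    also have "\<dots> \<le> k * (4 * re_psi x)" using k by (intro mult_left_mono dir_K_le_re_psi) auto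
    finally show ?thesis using k by (simp add: field_simps)
  qed
  then have nondegenerate
    unfolding nondegenerate_def using T k by (intro exI[of _ T] exI[of _ "1 / (4 * k)"] conjI) auto
  moreover have h_decay
  proof -
    \<comment> \<open>One direction suffices: \<open>dir_h\<close> in any direction is at most h,
      and the hypothesis bounds h by \<open>dir_K\<close> in every direction.\<close>
    obtain e :: "real^'d" where e: "norm e = 1" using nonempty_Basis norm_Basis by blast
    have ne: "e /\<^sub>R r \<noteq> 0" "norm (e /\<^sub>R r) = 1 / r" if "0 < r" for r
      using e that by (auto simp: divide_inverse)
    \<comment> \<open>The share of \<open>dir_h\<close> that survives a doubling: the loss is 3/4 of
      \<open>dir_K\<close>, which is at least \<open>dir_h\<close> / k. Positivity uses k \<ge>
      2.\<close>
    define q where "q = 1 - 3 / (4 * k)"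
    have q: "0 < q" "q < 1" using k by (auto simp: q_def field_simps)
    have hg: "h r \<le> k * dir_K (e /\<^sub>R r)" and gh: "dir_h (e /\<^sub>R r) \<le> h r" if r: "T < r" for r
    proof -
      have r0: "0 < r" using r T by simp
      have "1 / r < 1 / T" using r T by (intro divide_strict_left_mono) auto
      then show "h r \<le> k * dir_K (e /\<^sub>R r)" using hK[of "e /\<^sub>R r"] ne[OF r0] by simp
      show "dir_h (e /\<^sub>R r) \<le> h r" using dir_h_le_h[of "e /\<^sub>R r"] ne[OF r0] by simp
    qed
    have step: "dir_h (e /\<^sub>R (2 * r)) \<le> q * dir_h (e /\<^sub>R r)" if r: "T < r" for r
    proof -
      have "dir_h (e /\<^sub>R (2 * r)) = dir_h ((e /\<^sub>R r) /\<^sub>R 2)" by (simp add: mult.commute)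
      also have "\<dots> \<le> dir_h (e /\<^sub>R r) - 3 / 4 * dir_K (e /\<^sub>R r)" by (rule dir_h_half_le)
      also have "\<dots> \<le> dir_h (e /\<^sub>R r) - 3 / 4 * (dir_h (e /\<^sub>R r) / k)"
        using hg[OF r] gh[OF r] k by (auto simp: field_simps)
      also have "\<dots> = q * dir_h (e /\<^sub>R r)" by (simp add: q_def algebra_simps)
      finally show ?thesis .
    qed
    have geom: "dir_h (e /\<^sub>R (2 ^ n * r)) \<le> q ^ n * dir_h (e /\<^sub>R r)" if r: "T < r" for n r
    proof (induction n)
      case (Suc n)
      have "1 * r \<le> 2 ^ n * r" using r T by (intro mult_right_mono) auto
      then have "dir_h (e /\<^sub>R (2 * (2 ^ n * r))) \<le> q * dir_h (e /\<^sub>R (2 ^ n * r))" using r by (intro step) simp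
      also have "\<dots> \<le> q * (q ^ n * dir_h (e /\<^sub>R r))" using q Suc by (intro mult_left_mono) auto
      finally show ?case by (simp add: mult.assoc)
    qed simp
    \<comment> \<open>Returning from the direction e to h costs a factor k, hence the target 1 / (2
      k). The successor taken next ensures that the dilation 2^n is at least 2.\<close>
    obtain n0 where n0: "q ^ n0 < 1 / (2 * k)" using real_arch_pow_inv[of "1 / (2 * k)" q] q k by auto
    define n where "n = Suc n0"
    have "q ^ n \<le> q ^ n0" unfolding n_def using q by (intro power_decreasing) auto
    then have "k * q ^ n \<le> k * (1 / (2 * k))" using n0 k by (intro mult_left_mono) auto
    then have n: "k * q ^ n \<le> 1 / 2" using k by simp
    have "h (2 ^ n * r) \<le> h r / 2" if r: "T < r" for r
    proof -
      have "1 * r \<le> 2 ^ n * r" using r T by (intro mult_right_mono) auto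
      then have "h (2 ^ n * r) \<le> k * dir_K (e /\<^sub>R (2 ^ n * r))" using r by (intro hg) simp
      also have "\<dots> \<le> k * (q ^ n * h r)"
      proof (rule mult_left_mono)
        have "dir_K (e /\<^sub>R (2 ^ n * r)) \<le> dir_h (e /\<^sub>R (2 ^ n * r))" by (rule dir_K_le_dir_h)
        also have "\<dots> \<le> q ^ n * dir_h (e /\<^sub>R r)" by (rule geom[OF r])
        also have "\<dots> \<le> q ^ n * h r" using q by (intro mult_left_mono gh r) auto
        finally show "dir_K (e /\<^sub>R (2 ^ n * r)) \<le> q ^ n * h r" .
      qed (use k in simp)
      also have "\<dots> \<le> 1 / 2 * h r"
        unfolding mult.assoc[symmetric] using n h_pos[of r] r T by (intro mult_right_mono) auto
      finally show ?thesis by simp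
    qed
    moreover have "(2::real) ^ 1 \<le> 2 ^ n" unfolding n_def by (intro power_increasing) auto
    ultimately show ?thesis unfolding h_decay_def using T
      by (intro exI[of _ T] exI[of _ "2 ^ n"] conjI) auto
  qed
  ultimately show ?R by simp
next
  assume R: ?R
  obtain R1 \<alpha> where R1: "0 < R1" and \<alpha>: "0 < \<alpha>" "\<alpha> \<le> 1"
    and dec: "\<And>r s. R1 < r \<Longrightarrow> r \<le> s \<Longrightarrow> h s \<le> 2 * (r / s) powr \<alpha> * h r"
    using h_decay_powr R by blast
  obtain R2 c where R2: "0 < R2" and c: "0 < c"
    and nd: "\<And>x. x \<noteq> 0 \<Longrightarrow> norm x < 1 / R2 \<Longrightarrow> c * h (1 / norm x) \<le> re_psi x"
    using R unfolding nondegenerate_def by blast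
  define T where "T = max R1 R2"
  have T: "0 < T" using R1 by (simp add: T_def)
  have T1: "1 / T \<le> 1 / R1" and T2: "1 / T \<le> 1 / R2"
    using R1 R2 by (auto simp: T_def intro!: divide_left_mono)
  \<comment> \<open>Large enough that (4 / c) l^(-\<alpha>) \<le> 1/2, so that \<open>dir_h\<close>
    at x / l is at most half of \<open>dir_h x\<close>.\<close>
  define l where "l = max 1 ((8 / c) powr (1 / \<alpha>))"
  have l: "1 \<le> l" by (simp add: l_def)
  have "8 / c = ((8 / c) powr (1 / \<alpha>)) powr \<alpha>" using \<alpha> c by (simp add: powr_powr)
  also have "\<dots> \<le> l powr \<alpha>" using \<alpha> by (intro powr_mono2) (auto simp: l_def)
  finally have l\<alpha>: "4 / c * (1 / l) powr \<alpha> \<le> 1 / 2"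
    using l c by (simp add: powr_divide field_simps)
  define c4 where "c4 = max 1 (8 / c * l\<^sup>2)"
  have "psi_star \<Psi> (norm y) \<le> c4 * dir_K y" if y: "norm y < 1 / (l * T)" for y
  proof (cases "y = 0")
    case True
    have "0 \<le> c4 * dir_K 0" using dir_K_nonneg[of 0] by (simp add: c4_def)
    then show ?thesis using True by (simp add: psi_star_0)
  next
    case False
    \<comment> \<open>Decay compares two radii, so the estimate at y is obtained from the larger
      frequency l y; it stays in the admissible range because |y| < 1 / (l T).\<close>
    define x where "x = l *\<^sub>R y"
    have x: "x \<noteq> 0" "x /\<^sub>R l = y" "norm x = l * norm y" using False l by (auto simp: x_def)
    have xT: "norm x < 1 / T" using y l T by (simp add: x field_simps)
    have h_le: "h (1 / norm x) \<le> 2 / c * dir_h x"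
      using nd[OF x(1)] xT T2 re_psi_le_dir_h[of x] c by (simp add: field_simps)
    have "dir_h y \<le> h (1 / norm y)" by (rule dir_h_le_h[OF False])
    also have "\<dots> \<le> 2 * ((1 / norm x) / (1 / norm y)) powr \<alpha> * h (1 / norm x)"
    proof (rule dec)
      have "norm x < 1 / R1" using xT T1 by simp
      then show "R1 < 1 / norm x" using R1 x(1) by (simp add: field_simps)
      have "1 * norm y \<le> norm x" unfolding x(3) using l by (intro mult_right_mono) auto
      then show "1 / norm x \<le> 1 / norm y" using False x by (intro divide_left_mono) auto
    qed
    also have "(1 / norm x) / (1 / norm y) = 1 / l" using False by (simp add: x(3))
    also have "2 * (1 / l) powr \<alpha> * h (1 / norm x) \<le> 2 * (1 / l) powr \<alpha> * (2 / c * dir_h x)"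
      by (intro mult_left_mono h_le) auto
    also have "\<dots> = 4 / c * (1 / l) powr \<alpha> * dir_h x" by simp
    also have "\<dots> \<le> 1 / 2 * dir_h x"
      using order_trans[OF dir_K_nonneg dir_K_le_dir_h[of x]] by (intro mult_right_mono l\<alpha>)
    finally have "dir_h x \<le> 2 * (l\<^sup>2 * dir_K y)" using dir_h_diff_le[OF l, of x] by (simp add: x)
    have "psi_star \<Psi> (norm y) \<le> psi_star \<Psi> (norm x)"
      unfolding x(3) using l False mult_right_mono[of 1 l "norm y"] by (intro psi_star_mono) auto
    also have "\<dots> \<le> 2 * h (1 / norm x)" using x(1) by (intro psi_star_le_h) auto
    also have "\<dots> \<le> 2 * (2 / c * dir_h x)" using h_le by simp
    also have "\<dots> \<le> 2 * (2 / c * (2 * (l\<^sup>2 * dir_K y)))"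
      using c \<open>dir_h x \<le> 2 * (l\<^sup>2 * dir_K y)\<close> by (intro mult_left_mono) auto
    also have "\<dots> = 8 / c * l\<^sup>2 * dir_K y" by simp
    also have "\<dots> \<le> c4 * dir_K y" unfolding c4_def by (intro mult_right_mono dir_K_nonneg) auto
    finally show ?thesis .
  qed
  moreover have "0 < l * T" "1 \<le> c4" using l T by (auto simp: c4_def)
  ultimately show ?L by (intro exI[of _ "l * T"] conjI exI[of _ c4]) auto
qed

end

section \<open>Equivalence of the four conditions for the process\<close>

theorem theorem3p6:
  fixes M :: "'a measure" and Y :: "real \<Rightarrow> 'a \<Rightarrow> real^'d"
    and A :: "real^'d^'d" and N :: "(real^'d) measure" and b :: "real^'d"
  assumes levy: "levy_process M Y"
    and A: "sym_nonneg_matrix A"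
    and N: "levy_measure N"
    and charfun: "\<And>t x. 0 \<le> t \<Longrightarrow>
        (\<integral> \<omega>. exp (\<i> * complex_of_real (x \<bullet> Y t \<omega>)) \<partial>M) = exp (- (complex_of_real t * levy_exponent A N b x))"
    and h0: "filterlim (hfun A N) at_top (at_right 0)"
  defines "\<Psi> \<equiv> levy_exponent A N b"
    and "d \<equiv> real CARD('d)"
  shows
   "((\<exists>T1>0. \<exists>c1>0. \<forall>t>T1. \<exists>p. (\<forall>x. 0 \<le> p x) \<and> p \<in> borel_measurable lborel \<and>
        distr M lborel (Y t) = density lborel (\<lambda>x. ennreal (p x)) \<and>
        (\<forall>x. p x \<le> c1 * hinv A N (1 / t) powr (- d)))
    \<longleftrightarrow>
     (\<exists>T2>0. \<exists>c2>0. \<forall>t>T2.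
        (\<integral>\<^sup>+ z. ennreal (exp (- t * Re (\<Psi> z))) \<partial>lborel) \<le> ennreal (c2 * hinv A N (1 / t) powr (- d))))
   \<and>
   ((\<exists>T1>0. \<exists>c1>0. \<forall>t>T1. \<exists>p. (\<forall>x. 0 \<le> p x) \<and> p \<in> borel_measurable lborel \<and>
        distr M lborel (Y t) = density lborel (\<lambda>x. ennreal (p x)) \<and>
        (\<forall>x. p x \<le> c1 * hinv A N (1 / t) powr (- d)))
    \<longleftrightarrow>
     ((\<exists>T3>0. \<exists>c3. 0 < c3 \<and> c3 \<le> 1 \<and> (\<exists>\<alpha>3. 0 < \<alpha>3 \<and> \<alpha>3 \<le> 2 \<and>
        (\<forall>x. norm x < 1 / T3 \<longrightarrow> c3 * psi_star \<Psi> (norm x) \<le> Re (\<Psi> x)) \<and>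
        (\<forall>l r. 0 < l \<and> l \<le> 1 \<and> 0 < r \<and> r < 1 / T3 \<longrightarrow>
           psi_star \<Psi> (l * r) \<le> (1 / c3) * l powr \<alpha>3 * psi_star \<Psi> r)))
      \<and> (\<exists>t0>0. integrable lborel (\<lambda>z. exp (- (complex_of_real t0 * \<Psi> z))))))
   \<and>
   ((\<exists>T1>0. \<exists>c1>0. \<forall>t>T1. \<exists>p. (\<forall>x. 0 \<le> p x) \<and> p \<in> borel_measurable lborel \<and>
        distr M lborel (Y t) = density lborel (\<lambda>x. ennreal (p x)) \<and>
        (\<forall>x. p x \<le> c1 * hinv A N (1 / t) powr (- d)))
    \<longleftrightarrow>
     ((\<exists>T4>0. \<exists>c4\<ge>1. \<forall>x. norm x < 1 / T4 \<longrightarrow>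
        psi_star \<Psi> (norm x) \<le> c4 * (x \<bullet> (A *v x) +
          (\<integral> z. indicator {z. \<bar>x \<bullet> z\<bar> < 1} z * (x \<bullet> z)\<^sup>2 \<partial>N)))
      \<and> (\<exists>t0>0. integrable lborel (\<lambda>z. exp (- (complex_of_real t0 * \<Psi> z))))))"
proof -
  interpret prob_space M using levy by (simp add: levy_process_def)
  have Y[measurable]: "Y t \<in> borel_measurable M" for t using levy by (simp add: levy_process_def)
  interpret unbounded_levy_triplet A N b by unfold_locales fact+
  let ?\<mu> = "\<lambda>t. distr M borel (Y t)"
  have \<mu>: "prob_space (?\<mu> t)" for t by (rule prob_space_distr) simp
  have cf: "char_fun (?\<mu> t) z = exp (- (complex_of_real t * levy_exponent A N b z))" if "0 \<le> t" for t z
    unfolding char_fun_def by (subst integral_distr) (auto simp: charfun[OF that])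
  have norm_cf: "cmod (exp (- (complex_of_real t * levy_exponent A N b z))) = exp (- t * re_psi z)" for t z
    by (simp add: Re_exponent)
  \<comment> \<open>The exponential is the characteristic function of \<open>Y t\<close>, which
    settles its measurability without a separate argument for Psi.\<close>
  have cf_meas: "(\<lambda>z. exp (- (complex_of_real t * levy_exponent A N b z))) \<in> borel_measurable borel" if "0 \<le> t" for t
    using borel_measurable_char_fun[OF \<mu>[of t]] unfolding cf[OF that, abs_def] by simp
  have integrable_iff: "integrable lborel (\<lambda>z. exp (- (complex_of_real t * levy_exponent A N b z))) \<longleftrightarrow> exp_int t < \<infinity>" if "0 < t" for t
    unfolding integrable_iff_bounded norm_cf using cf_meas[of t] that by simp
  let ?D1 = "\<exists>T1>0. \<exists>c1>0. \<forall>t>T1. \<exists>p. (\<forall>x. 0 \<le> p x) \<and> p \<in> borel_measurable lborel \<and>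
        distr M lborel (Y t) = density lborel (\<lambda>x. ennreal (p x)) \<and>
        (\<forall>x. p x \<le> c1 * hinv A N (1 / t) powr (- d))"
  let ?D2 = "\<exists>T2>0. \<exists>c2>0. \<forall>t>T2. exp_int t \<le> ennreal (c2 * hinv A N (1 / t) powr (- d))"
  \<comment> \<open>Both (D1) and (D2) imply this form with doubled time, so one extraction of decay
    and nondegeneracy serves both.\<close>
  let ?D2' = "\<exists>T2>0. \<exists>c2>0. \<forall>t>T2. exp_int (2 * t) \<le> ennreal (c2 * hinv A N (1 / t) powr (- d))"
  let ?I = "\<exists>t0>0. exp_int t0 < \<infinity>"
  have distr_lborel: "distr M lborel (Y t) = ?\<mu> t" for t by (rule distr_cong) auto
  have D1_D2': ?D2' if D1: ?D1
  proof -
    obtain T c where T: "0 < T" and c: "0 < c" and ex: "\<And>t. T < t \<Longrightarrow> \<exists>p. (\<forall>x. 0 \<le> p x) \<and> p \<in> borel_measurable lborel \<and>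
        ?\<mu> t = density lborel (\<lambda>x. ennreal (p x)) \<and> (\<forall>x. p x \<le> c * hinv A N (1 / t) powr (- d))"
      using D1 unfolding distr_lborel by blast
    have "exp_int (2 * t) \<le> ennreal ((2 * pi) ^ CARD('d) * c * hinv A N (1 / t) powr (- d))" if t: "T < t" for t
    proof -
      obtain p where p: "\<And>x. 0 \<le> p x" "p \<in> borel_measurable lborel"
        "?\<mu> t = density lborel (\<lambda>x. ennreal (p x))" "\<And>x. p x \<le> c * hinv A N (1 / t) powr (- d)"
        using ex[OF t] by blast
      have "(\<integral>\<^sup>+z. ennreal ((cmod (char_fun (?\<mu> t) z))\<^sup>2) \<partial>lborel) \<le> ennreal ((2 * pi) ^ DIM(real^'d) * (c * hinv A N (1 / t) powr (- d)))"
        using p by (intro char_fun_L2_bound \<mu>) auto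
      \<comment> \<open>Squaring the modulus is what doubles the time.\<close>
      moreover have "(cmod (char_fun (?\<mu> t) z))\<^sup>2 = exp (- (2 * t) * re_psi z)" for z
        using T t by (subst cf) (simp_all only: norm_cf exp_double[symmetric], simp_all)
      ultimately show ?thesis by (simp add: mult.assoc)
    qed
    then show ?thesis using T c by (intro exI[of _ T] exI[of _ "(2 * pi) ^ CARD('d) * c"] conjI) auto
  qed
  have D2_D1: ?D1 if D2: ?D2
  proof -
    obtain T c where T: "0 < T" and c: "0 < c" and le: "\<And>t. T < t \<Longrightarrow> exp_int t \<le> ennreal (c * hinv A N (1 / t) powr (- d))"
      using D2 by blast
    have "\<exists>p. (\<forall>x. 0 \<le> p x) \<and> p \<in> borel_measurable lborel \<and> ?\<mu> t = density lborel (\<lambda>x. ennreal (p x)) \<and>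
        (\<forall>x. p x \<le> c / (2 * pi) ^ CARD('d) * hinv A N (1 / t) powr (- d))" if t: "T < t" for t
    proof -
      have "0 < hinv A N (1 / t)" using t T by (intro hinv_pos) simp
      then have "0 < c * hinv A N (1 / t) powr (- d)" using c by simp
      moreover have "(\<integral>\<^sup>+z. ennreal (cmod (char_fun (?\<mu> t) z)) \<partial>lborel) \<le> ennreal (c * hinv A N (1 / t) powr (- d))"
        using le[OF t] t T by (simp add: cf Re_exponent)
      ultimately show ?thesis
        using bounded_density_of_integrable_char_fun[OF \<mu>[of t]] by simp
    qed
    then show ?thesis unfolding distr_lborel using T c
      by (intro exI[of _ T] exI[of _ "c / (2 * pi) ^ CARD('d)"] conjI) auto
  qed
  have D2_D2': ?D2' if D2: ?D2
  proof -
    obtain T c where T: "0 < T" and c: "0 < c" and le: "\<And>t. T < t \<Longrightarrow> exp_int t \<le> ennreal (c * hinv A N (1 / t) powr (- d))"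
      using D2 by blast
    have "exp_int (2 * t) \<le> ennreal (c * hinv A N (1 / t) powr (- d))" if "T < t" for t
      using exp_int_antimono[of t "2 * t"] le[OF that] that T by (auto intro: order_trans)
    then show ?thesis using T c by blast
  qed
  have core: "h_decay \<and> nondegenerate \<and> ?I" if D2': ?D2'
  proof -
    obtain T c where "0 < T" "0 < c" and "\<And>t. T < t \<Longrightarrow> exp_int (2 * t) \<le> ennreal (c * hinv A N (1 / t) powr (- real CARD('d)))"
      using D2' unfolding d_def by blast
    then show ?thesis
      using bound_imp_h_decay bound_imp_nondegenerate bound_imp_exp_int_finite by blast
  qed
  have core_D2: ?D2 if "h_decay \<and> nondegenerate \<and> ?I"
    using that exp_int_upper unfolding d_def by blast
  have D1_iff: "?D1 \<longleftrightarrow> h_decay \<and> nondegenerate \<and> ?I"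
    by (rule iffI[OF core[OF D1_D2'] D2_D1[OF core_D2]])
  have D2_iff: "?D2 \<longleftrightarrow> h_decay \<and> nondegenerate \<and> ?I"
    by (rule iffI[OF core[OF D2_D2'] core_D2])
  have I_iff: "(\<exists>t0>0. integrable lborel (\<lambda>z. exp (- (complex_of_real t0 * levy_exponent A N b z)))) \<longleftrightarrow> ?I"
    using integrable_iff by blast
  show ?thesis
    unfolding \<Psi>_def D1_iff weak_scaling_iff truncated_moment_iff[unfolded dir_K_def] I_iff
    unfolding Re_exponent D2_iff by (simp only: conj_assoc)
qed

end
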